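(* An ascending $\Omega3$ move is forward if and only if it is positive. A descending $\Omega3$ move is forward if and only if it is negative.
   Context: The moves are Reidemeister moves of type III ($\Omega3$ moves) on oriented knot diagrams in the plane $\mathbb{R}^2$. Three strands take part in such a move: a bottom, a middle and a top one. The vanishing triangle is the triangle formed by the three edges, contained in the diagram of the move, whose ends are the three crossings involved in the move (there is one such triangle before the move and one after it). Ascending/descending: follow the orientation of the knot diagram. The move is ascending if the three segments involved are passed in the order bottom-middle-top, and descending if they are passed in the order top-middle-bottom (the starting point on the closed diagram is arbitrary, so orders are understood up to cyclic permutation). This classification does not change when the move is reversed. Positive/negative: assign to the vanishing triangle the orientation corresponding to the order in which its sides appear when moving along the oriented diagram beginning at an arbitrary point. Let $n$ be the number of sides of the triangle whose orientation (inherited from the diagram) agrees with this orientation of the triangle, and let $q=(-1)^n$. The move is positive if it changes $q$ from $-1$ to $+1$, and negative if the reverse occurs. Forward/backward: there are eight types of oriented $\Omega3$ moves (according to the orientations of the strands and the over/under information), and for each type one of the two directions of performing the move is called forward and the opposite one backward. The forward direction is the one in which the quantity $\mathrm{SCI}(D)=\sum_{c}\mathrm{sgn}(c)\,\mathrm{ind}(c)$ increases by $1$ (in the backward direction it decreases by $1$). Here the sum runs over all crossings $c$ of the diagram $D$, $\mathrm{sgn}(c)=\pm1$ is the sign of the crossing, and $\mathrm{ind}(c)$ is the average, over the four regions of the complement adjacent to $c$ (counted with multiplicity), of the index of the region, i.e. the winding number of the oriented underlying curve around any point of that region. *)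

theory Defs
  imports "HOL-Complex_Analysis.Complex_Analysis"
begin

section \<open>Oriented knot diagrams in the plane\<close>

text \<open>
  The plane is \<^typ>\<open>complex\<close>.  The underlying curve of a diagram is a 1-periodic immersion of the
  line, so the time \<open>t\<close> is a point of the circle \<open>R / Z\<close> and \<open>curve D\<close>, restricted to
  \<open>[0,1]\<close>, is the closed path used by the library.  The over/under information is the set of those
  times at which the curve runs through a crossing along the upper branch.
\<close>

record knot_diagram =
  curve :: "real \<Rightarrow> complex"
  overpass :: "real set"

definition tangent :: "knot_diagram \<Rightarrow> real \<Rightarrow> complex" where
  "tangent D t = vector_derivative (curve D) (at t)"

text \<open>The determinant of two plane vectors.\<close>

definition det2 :: "complex \<Rightarrow> complex \<Rightarrow> real" where
  "det2 u v = Re u * Im v - Im u * Re v"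

definition double_times :: "knot_diagram \<Rightarrow> real \<Rightarrow> real \<Rightarrow> bool" where
  "double_times D s t \<longleftrightarrow> curve D s = curve D t \<and> s - t \<notin> \<int>"

definition crossings :: "knot_diagram \<Rightarrow> complex set" where
  "crossings D = {c. \<exists>s t. double_times D s t \<and> curve D s = c}"

definition is_knot_diagram :: "knot_diagram \<Rightarrow> bool" where
  "is_knot_diagram D \<longleftrightarrow>
     (\<forall>t. curve D (t + 1) = curve D t) \<and>
     curve D C1_differentiable_on UNIV \<and>
     (\<forall>t. tangent D t \<noteq> 0) \<and>
     finite (crossings D) \<and>
     (\<forall>r s t. curve D r = curve D s \<and> curve D s = curve D t \<longrightarrow>
        r - s \<in> \<int> \<or> s - t \<in> \<int> \<or> r - t \<in> \<int>) \<and>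
     (\<forall>s t. double_times D s t \<longrightarrow> det2 (tangent D s) (tangent D t) \<noteq> 0) \<and>
     (\<forall>t. t + 1 \<in> overpass D \<longleftrightarrow> t \<in> overpass D) \<and>
     (\<forall>t \<in> overpass D. curve D t \<in> crossings D) \<and>
     (\<forall>s t. double_times D s t \<longrightarrow> (s \<in> overpass D \<longleftrightarrow> t \<notin> overpass D))"


section \<open>Signs and indices of crossings\<close>

definition over_time :: "knot_diagram \<Rightarrow> complex \<Rightarrow> real" where
  "over_time D c = (THE t. t \<in> {0..<1} \<and> curve D t = c \<and> t \<in> overpass D)"

definition under_time :: "knot_diagram \<Rightarrow> complex \<Rightarrow> real" where
  "under_time D c = (THE t. t \<in> {0..<1} \<and> curve D t = c \<and> t \<notin> overpass D)"

text \<open>A crossing is positive iff the upper branch has to be turned counterclockwise (by an angle less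
  than \<open>\<pi>\<close>) in order to match the lower branch.\<close>

definition crossing_sign :: "knot_diagram \<Rightarrow> complex \<Rightarrow> real" where
  "crossing_sign D c =
     sgn (det2 (tangent D (over_time D c)) (tangent D (under_time D c)))"

definition regions :: "knot_diagram \<Rightarrow> complex set set" where
  "regions D = components (- range (curve D))"

definition region_index :: "knot_diagram \<Rightarrow> complex set \<Rightarrow> real" where
  "region_index D R = Re (winding_number (curve D) (SOME z. z \<in> R))"

text \<open>The two branches at a crossing with tangent vectors \<open>u\<close> and \<open>v\<close> divide a small
  neighbourhood into four corners, which contain the directions \<open>u + v\<close>, \<open>u - v\<close>, \<open>- u + v\<close> and
  \<open>- u - v\<close>.  Indexing the adjacent regions by the corners counts them with multiplicity.\<close>

definition corner_region :: "knot_diagram \<Rightarrow> complex \<Rightarrow> real \<Rightarrow> real \<Rightarrow> complex set" where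
  "corner_region D c x y =
     (THE R. R \<in> regions D \<and>
        (\<forall>\<^sub>F e in at_right 0.
           c + e *\<^sub>R (x *\<^sub>R tangent D (over_time D c) + y *\<^sub>R tangent D (under_time D c)) \<in> R))"

definition crossing_index :: "knot_diagram \<Rightarrow> complex \<Rightarrow> real" where
  "crossing_index D c =
     (\<Sum>x\<in>{1, -1}. \<Sum>y\<in>{1, -1}. region_index D (corner_region D c x y)) / 4"

definition SCI :: "knot_diagram \<Rightarrow> real" where
  "SCI D = (\<Sum>c\<in>crossings D. crossing_sign D c * crossing_index D c)"


section \<open>Reidemeister moves of type III\<close>

text \<open>
  The two diagrams of a move differ only inside a disc, which the curve traverses exactly during the
  time intervals from \<open>enter M i\<close> to \<open>leave M i\<close>, for \<open>i = 0, 1, 2\<close>.  The strands are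
  numbered in the order in which they are passed; times are real numbers modulo 1, so every choice of
  the strand numbered 0 (that is, every starting point) is allowed.
\<close>

record omega3_data =
  before :: knot_diagram
  after :: knot_diagram
  disc :: "complex set"
  enter :: "nat \<Rightarrow> real"
  leave :: "nat \<Rightarrow> real"

definition strand :: "omega3_data \<Rightarrow> nat \<Rightarrow> real set" where
  "strand M i = {enter M i<..<leave M i}"

definition cyc_next :: "nat \<Rightarrow> nat" where
  "cyc_next i = (i + 1) mod 3"

definition cyc_prev :: "nat \<Rightarrow> nat" where
  "cyc_prev i = (i + 2) mod 3"

text \<open>In the next four definitions, \<open>D\<close> is the diagram before or after the move \<open>M\<close>.  The
  first one gives the time at which strand \<open>i\<close> meets strand \<open>j\<close>.\<close>

definition meet_time :: "omega3_data \<Rightarrow> knot_diagram \<Rightarrow> nat \<Rightarrow> nat \<Rightarrow> real" where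
  "meet_time M D i j = (THE t. t \<in> strand M i \<and> (\<exists>s\<in>strand M j. curve D s = curve D t))"

definition strand_over :: "omega3_data \<Rightarrow> knot_diagram \<Rightarrow> nat \<Rightarrow> nat \<Rightarrow> bool" where
  "strand_over M D i j \<longleftrightarrow> meet_time M D i j \<in> overpass D"

definition bottom_middle_top ::
    "omega3_data \<Rightarrow> knot_diagram \<Rightarrow> nat \<Rightarrow> nat \<Rightarrow> nat \<Rightarrow> bool" where
  "bottom_middle_top M D b m t \<longleftrightarrow>
     {b, m, t} = {0, 1, 2} \<and> strand_over M D m b \<and> strand_over M D t m \<and> strand_over M D t b"

definition three_strands :: "omega3_data \<Rightarrow> knot_diagram \<Rightarrow> bool" where
  "three_strands M D \<longleftrightarrow>
     (\<forall>i<3. curve D ` strand M i \<subseteq> interior (disc M) \<and>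
            curve D (enter M i) \<in> frontier (disc M) \<and>
            curve D (leave M i) \<in> frontier (disc M) \<and>
            inj_on (curve D) {enter M i..leave M i}) \<and>
     (\<forall>t\<in>{enter M 0..<enter M 0 + 1} - (\<Union>i<3. {enter M i..leave M i}).
        curve D t \<notin> disc M) \<and>
     crossings D \<inter> frontier (disc M) = {} \<and>
     (\<forall>i<3. \<forall>j<3. i \<noteq> j \<longrightarrow>
        (\<exists>!t. t \<in> strand M i \<and> (\<exists>s\<in>strand M j. curve D s = curve D t))) \<and>
     (\<exists>b m t. bottom_middle_top M D b m t)"

text \<open>
  Three arcs in a disc with given end points, any two of which cross exactly once, form one of two
  configurations up to isotopy of the disc relative to its boundary; they are distinguished by the order
  in which each arc meets the other two.  The move replaces one configuration by the other one and keeps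
  the over/under relation between the strands and everything outside the disc.
\<close>

definition omega3_move :: "omega3_data \<Rightarrow> bool" where
  "omega3_move M \<longleftrightarrow>
     is_knot_diagram (before M) \<and> is_knot_diagram (after M) \<and>
     disc M homeomorphic cball (0 :: complex) 1 \<and>
     enter M 0 < leave M 0 \<and> leave M 0 < enter M 1 \<and>
     enter M 1 < leave M 1 \<and> leave M 1 < enter M 2 \<and>
     enter M 2 < leave M 2 \<and> leave M 2 < enter M 0 + 1 \<and>
     three_strands M (before M) \<and> three_strands M (after M) \<and>
     (\<forall>t\<in>{enter M 0..<enter M 0 + 1} - (\<Union>i<3. strand M i).
        curve (after M) t = curve (before M) t \<and>
        (t \<in> overpass (after M) \<longleftrightarrow> t \<in> overpass (before M))) \<and>
     (\<forall>i<3. \<forall>j<3. i \<noteq> j \<longrightarrow>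
        (strand_over M (after M) i j \<longleftrightarrow> strand_over M (before M) i j)) \<and>
     (\<forall>i<3. meet_time M (after M) i (cyc_next i) < meet_time M (after M) i (cyc_prev i) \<longleftrightarrow>
            meet_time M (before M) i (cyc_prev i) < meet_time M (before M) i (cyc_next i))"

definition ascending :: "omega3_data \<Rightarrow> bool" where
  "ascending M \<longleftrightarrow> (\<exists>i<3. bottom_middle_top M (before M) i (cyc_next i) (cyc_prev i))"

definition descending :: "omega3_data \<Rightarrow> bool" where
  "descending M \<longleftrightarrow> (\<exists>i<3. bottom_middle_top M (before M) (cyc_prev i) (cyc_next i) i)"

text \<open>
  Side \<open>i\<close> of the vanishing triangle is the part of strand \<open>i\<close> between its crossings with the other
  two strands.  If the boundary of the triangle is traversed so that the sides appear in their order
  along the diagram, then side \<open>i\<close> is run through from the vertex on side \<open>cyc_prev i\<close> to the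
  vertex on side \<open>cyc_next i\<close>.
\<close>

definition side_agrees :: "omega3_data \<Rightarrow> knot_diagram \<Rightarrow> nat \<Rightarrow> bool" where
  "side_agrees M D i \<longleftrightarrow> meet_time M D i (cyc_prev i) < meet_time M D i (cyc_next i)"

definition triangle_q :: "omega3_data \<Rightarrow> knot_diagram \<Rightarrow> int" where
  "triangle_q M D = (-1) ^ card {i. i < 3 \<and> side_agrees M D i}"

definition positive_move :: "omega3_data \<Rightarrow> bool" where
  "positive_move M \<longleftrightarrow> triangle_q M (before M) = -1 \<and> triangle_q M (after M) = 1"

definition negative_move :: "omega3_data \<Rightarrow> bool" where
  "negative_move M \<longleftrightarrow> triangle_q M (before M) = 1 \<and> triangle_q M (after M) = -1"

definition forward_move :: "omega3_data \<Rightarrow> bool" where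
  "forward_move M \<longleftrightarrow> SCI (after M) = SCI (before M) + 1"

end

theory Submission
  imports Defs
begin

text \<open>
  Cut the circle of times in the three gaps between the strands and close up each of the three
  resulting arcs of the diagram by paths that avoid the disc of the move. This gives three loops
  \<open>L\<^sub>0\<close>, \<open>L\<^sub>1\<close>, \<open>L\<^sub>2\<close> such that \<open>L\<^sub>i\<close> meets the disc exactly in strand \<open>i\<close>, and the closing paths
  can be chosen so that they cancel: the winding number of the curve is the sum of those of the loops
  (\<open>winding_number_sum_loops\<close>).

  Let \<open>W\<^sub>i\<close> be the winding number of \<open>L\<^sub>i\<close>, let \<open>c\<^sub>i\<^sub>j\<close> be the crossing of strands \<open>i\<close> and \<open>j\<close>, and let \<open>s\<^sub>i\<^sub>j\<close> be
  the sign of the determinant of their velocities there. Going along strand \<open>j\<close>, the value of \<open>W\<^sub>i\<close> is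
  constant except for a jump by \<open>s\<^sub>i\<^sub>j\<close> at \<open>c\<^sub>i\<^sub>j\<close> (\<open>loop_winding_along_strand\<close>). On the other hand, the strands
  before and after the move are homotopic inside the disc, so \<open>W\<^sub>i\<close> is unchanged outside the disc and, by
  continuity, at the points where the other strands enter and leave it (\<open>same_boundary_indices\<close>).
  Hence every \<open>s\<^sub>i\<^sub>j\<close>, being the difference of two such boundary values, is unchanged, and so is the sign
  of every crossing.

  The index of \<open>c\<^sub>i\<^sub>j\<close> is the sum of the averages of \<open>W\<^sub>i\<close>, \<open>W\<^sub>j\<close> and \<open>W\<^sub>k\<close> over the four corners, where \<open>k\<close> is
  the third strand. The average of \<open>W\<^sub>i\<close> is the mean of its boundary values on strand \<open>j\<close>, that of \<open>W\<^sub>j\<close> is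
  the mean of its boundary values on strand \<open>i\<close>, and \<open>W\<^sub>k\<close> is constant near \<open>c\<^sub>i\<^sub>j\<close>: there it has its entry value
  on strand \<open>i\<close> if \<open>c\<^sub>i\<^sub>j\<close> comes before \<open>c\<^sub>i\<^sub>k\<close> and its exit value otherwise (\<open>crossing_index_at_meet\<close>).
  The move reverses this order, so the index of \<open>c\<^sub>i\<^sub>j\<close> changes by \<open>s\<^sub>k\<^sub>i\<close> or \<open>- s\<^sub>k\<^sub>i\<close>. The same computation
  along strand \<open>j\<close> expresses the change through \<open>s\<^sub>k\<^sub>j\<close>; comparing the two ties the orders on the strands to
  the signs. Since crossings outside the disc contribute the same before and after, summing up yields
  \<open>SCI (after M) - SCI (before M) = q (o\<^sub>0\<^sub>1 + o\<^sub>1\<^sub>2 + o\<^sub>2\<^sub>0)\<close>, where \<open>q\<close> belongs to the triangle before the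
  move and \<open>o\<^sub>i\<^sub>j\<close> is \<open>1\<close> or \<open>- 1\<close> according to whether strand \<open>i\<close> is above or below strand \<open>j\<close>
  (\<open>SCI_change\<close>). The sum of the \<open>o\<^sub>i\<^sub>j\<close> is \<open>- 1\<close> for an ascending move and \<open>1\<close> for a descending one, and
  the move changes the sign of \<open>q\<close>.

  The analytic core is the local statement that a winding number jumps by one across a smooth simple
  arc (\<open>winding_number_jumps_across_arc\<close>); it rests on the formula for the winding number of an arc in a
  slit plane in terms of the logarithm.
\<close>

section \<open>Smooth arcs near a point\<close>

lemma det2_diff_scaleR: "det2 u (x - r *\<^sub>R u) = det2 u x"
  by (simp add: det2_def algebra_simps)

lemma abs_det2_le: "\<bar>det2 u v\<bar> \<le> norm u * norm v"
proof -
  have "det2 u v = Im (cnj u * v)" by (simp add: det2_def algebra_simps)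
  also have "\<bar>\<dots>\<bar> \<le> norm (cnj u * v)" by (rule abs_Im_le_cmod)
  finally show ?thesis by (simp add: norm_mult)
qed

lemma det2_scaleR_right: "det2 u (r *\<^sub>R v) = r * det2 u v"
  and det2_add_right: "det2 u (v + w) = det2 u v + det2 u w"
  and det2_self: "det2 u u = 0"
  and det2_swap: "det2 v u = - det2 u v"
  by (simp_all add: det2_def algebra_simps)

lemma tangent_window:
  fixes g :: "real \<Rightarrow> complex"
  assumes "(g has_vector_derivative u) (at t0)" and "e > 0"
  obtains d where "d > 0"
    and "\<And>t. \<bar>t - t0\<bar> < d \<Longrightarrow> norm (g t - g t0 - (t - t0) *\<^sub>R u) \<le> e * \<bar>t - t0\<bar>"
  using assms unfolding has_vector_derivative_def has_derivative_at_alt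
  by (metis real_norm_def)

text \<open>
  Near \<open>p\<close> the arc stays so close to its tangent line that it leaves free every double cone around the
  normal: a point of the arc at time \<open>t\<close> has distance at most \<open>\<eta> \<bar>t - t0\<bar>\<close> from the tangent line, while
  a point of the cone at comparable distance from \<open>p\<close> has distance at least proportional to \<open>\<rho>\<close>. The
  rest of the arc has positive distance from \<open>p\<close> by compactness.
\<close>

lemma cone_avoids_arc:
  fixes g :: "real \<Rightarrow> complex"
  assumes cont: "continuous_on {a..b} g" and p: "g t0 = p"
    and simple: "\<And>t. t \<in> {a..b} \<Longrightarrow> g t = p \<Longrightarrow> t = t0"
    and der: "(g has_vector_derivative u) (at t0)" and "u \<noteq> 0" and "\<rho> > 0"
  obtains \<epsilon> where "\<epsilon> > 0"
    and "\<And>x. \<lbrakk>x \<noteq> 0; norm x < \<epsilon>; \<rho> * norm x \<le> \<bar>det2 u x\<bar>\<rbrakk> \<Longrightarrow> p + x \<notin> g ` {a..b}"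
proof -
  define \<eta> where "\<eta> = min (norm u / 2) (\<rho> / 4)"
  have \<eta>: "\<eta> > 0" "\<eta> \<le> norm u / 2" "\<eta> \<le> \<rho> / 4"
    using \<open>u \<noteq> 0\<close> \<open>\<rho> > 0\<close> by (auto simp: \<eta>_def)
  obtain d where d: "d > 0"
    and win: "\<And>t. \<bar>t - t0\<bar> < d \<Longrightarrow> norm (g t - p - (t - t0) *\<^sub>R u) \<le> \<eta> * \<bar>t - t0\<bar>"
    using tangent_window[OF der \<open>\<eta> > 0\<close>] p by metis
  define K where "K = {a..b} - {t0 - d<..<t0 + d}"
  have "compact K" unfolding K_def by (intro compact_diff) auto
  then have "compact (g ` K)"
    by (intro compact_continuous_image continuous_on_subset[OF cont]) (auto simp: K_def)
  then have "open (- (g ` K))" by (simp add: compact_imp_closed open_Compl)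
  moreover have "p \<in> - (g ` K)" using simple d by (force simp: K_def)
  ultimately obtain \<epsilon> where \<epsilon>: "\<epsilon> > 0" "ball p \<epsilon> \<subseteq> - (g ` K)"
    by (meson openE)
  show thesis
  proof (rule that[OF \<epsilon>(1)])
    fix x :: complex
    assume x: "x \<noteq> 0" "norm x < \<epsilon>" "\<rho> * norm x \<le> \<bar>det2 u x\<bar>"
    show "p + x \<notin> g ` {a..b}"
    proof
      assume "p + x \<in> g ` {a..b}"
      then obtain t where t: "t \<in> {a..b}" "g t = p + x" by auto
      have "p + x \<in> ball p \<epsilon>" using x by (simp add: dist_norm)
      then have "g t \<notin> g ` K" using \<epsilon>(2) t(2) by (metis ComplD subsetD)
      then have "t \<notin> K" by blast
      then have "\<bar>t - t0\<bar> < d" using t by (auto simp: K_def)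
      from win[OF this] have 1: "norm (x - (t - t0) *\<^sub>R u) \<le> \<eta> * \<bar>t - t0\<bar>"
        by (simp add: t)
      have "\<bar>det2 u x\<bar> \<le> norm u * norm (x - (t - t0) *\<^sub>R u)"
        by (metis abs_det2_le det2_diff_scaleR)
      also have "\<dots> \<le> norm u * (\<eta> * \<bar>t - t0\<bar>)" using 1 by (rule mult_left_mono) simp
      finally have 2: "\<rho> * norm x \<le> norm u * (\<eta> * \<bar>t - t0\<bar>)" using x by simp
      have "\<bar>t - t0\<bar> * norm u \<le> norm x + norm (x - (t - t0) *\<^sub>R u)"
        by (metis norm_scaleR norm_minus_commute norm_triangle_sub)
      also have "\<dots> \<le> norm x + (norm u / 2) * \<bar>t - t0\<bar>"
        using 1 \<eta>(2) by (smt (verit) mult_right_mono abs_ge_zero)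
      finally have "\<bar>t - t0\<bar> * norm u / 2 \<le> norm x" by (simp add: algebra_simps)
      then have "\<rho> * (\<bar>t - t0\<bar> * norm u / 2) \<le> norm u * (\<eta> * \<bar>t - t0\<bar>)"
        using 2 \<open>\<rho> > 0\<close> by (smt (verit) mult_left_mono)
      also have "\<dots> \<le> norm u * ((\<rho> / 4) * \<bar>t - t0\<bar>)"
        using \<eta>(3) by (intro mult_left_mono mult_right_mono) auto
      finally have "\<rho> * (\<bar>t - t0\<bar> * norm u) \<le> 0" by (simp add: algebra_simps)
      then have "t = t0" using \<open>\<rho> > 0\<close> \<open>u \<noteq> 0\<close> by (auto simp: mult_le_0_iff)
      then show False using t p x by simp
    qed
  qed
qed

section \<open>Winding numbers of subpaths\<close>

lemma path_subpath_of_continuous: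
  fixes g :: "real \<Rightarrow> 'a::real_normed_vector"
  assumes "continuous_on {a..b} g" "a \<le> b"
  shows "path (subpath a b g)"
proof -
  have "(b - a) * x + a \<in> {a..b}" if "x \<in> {0..1}" for x
  proof -
    have "0 \<le> (b - a) * x" "(b - a) * x \<le> (b - a) * 1"
      using that assms by (intro mult_nonneg_nonneg mult_left_mono; simp)+
    then show ?thesis by simp
  qed
  then have "continuous_on {0..1} (\<lambda>x. g ((b - a) * x + a))"
    using assms(1) by (intro continuous_on_compose2[OF assms(1)] continuous_intros) auto
  then show ?thesis by (simp add: path_def subpath_def o_def)
qed

lemma winding_number_subpath_add:
  fixes g :: "real \<Rightarrow> complex"
  assumes cont: "continuous_on {a..c} g" and "a \<le> b" "b \<le> c" and z: "z \<notin> g ` {a..c}"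
  shows "winding_number (subpath a c g) z
       = winding_number (subpath a b g) z + winding_number (subpath b c g) z"
proof (cases "a = c")
  case True
  then show ?thesis using assms by simp
next
  case False
  with assms have ac: "a < c" by simp
  define h where "h = subpath a c g"
  define v where "v = (b - a) / (c - a)"
  have v: "v \<in> {0..1}" using assms ac by (auto simp: v_def field_simps)
  have cv: "(c - a) * v = b - a" using ac by (simp add: v_def)
  have "subpath 0 v h = subpath a b g"
  proof -
    have "(c - a) * (v * x) = (b - a) * x" for x
      by (metis cv mult.assoc)
    then show ?thesis by (simp only: h_def subpath_def diff_zero add_0_right)
  qed
  moreover have "subpath v 1 h = subpath b c g"
  proof -
    have "(c - a) * ((1 - v) * x + v) + a = (c - b) * x + b" for x
    proof -
      have "(c - a) * ((1 - v) * x + v) = ((c - a) - (c - a) * v) * x + (c - a) * v"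
        by (simp add: algebra_simps)
      then show ?thesis by (simp add: cv)
    qed
    then show ?thesis by (simp add: h_def subpath_def)
  qed
  moreover have "path h" "z \<notin> path_image h"
    using assms ac by (auto simp: h_def path_subpath_of_continuous path_image_subpath)
  ultimately show ?thesis
    using winding_number_subpath_combine[of h z 0 v 1] v by (simp add: h_def)
qed

text \<open>
  Moving the base point by a fractional amount \<open>f\<close> only exchanges the order of the two pieces
  \<open>[f, 1]\<close> and \<open>[1, 1 + f]\<close>, the second of which is a translate of \<open>[0, f]\<close>.
\<close>

lemma winding_number_period:
  fixes g :: "real \<Rightarrow> complex"
  assumes cont: "continuous_on UNIV g" and per: "\<And>t. g (t + 1) = g t" and z: "z \<notin> range g"
  shows "winding_number (subpath m (m + 1) g) z = winding_number g z"
proof -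
  have perZ: "g (t + of_int k) = g t" for t k
  proof (induction k rule: int_induct[where k = 0])
    case (step1 i)
    then show ?case using per[of "t + of_int i"] by (simp add: algebra_simps)
  next
    case (step2 i)
    then show ?case using per[of "t + of_int (i - 1)"] by (simp add: algebra_simps)
  qed simp
  have shift: "subpath (a + of_int k) (b + of_int k) g = subpath a b g" for a b k
    using perZ by (auto simp: subpath_def fun_eq_iff simp flip: add.assoc)
  have co: "continuous_on S g" for S using cont continuous_on_subset by blast
  have z': "z \<notin> g ` S" for S using z by auto
  define f where "f = frac m"
  have f: "0 \<le> f" "f \<le> 1" using frac_lt_1[of m] by (auto simp: f_def)
  have "m = f + of_int \<lfloor>m\<rfloor>" by (simp add: f_def frac_def)
  then have "subpath m (m + 1) g = subpath f (f + 1) g"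
    using shift[of f "\<lfloor>m\<rfloor>" "f + 1"] by (metis add.commute add.left_commute)
  then have "winding_number (subpath m (m + 1) g) z
      = winding_number (subpath f 1 g) z + winding_number (subpath 1 (f + 1) g) z"
    using winding_number_subpath_add[OF co, of f 1 "f + 1"] f z' by simp
  also have "subpath 1 (f + 1) g = subpath 0 f g"
    using shift[of 0 1 f] by simp
  also have "winding_number (subpath f 1 g) z + winding_number (subpath 0 f g) z
      = winding_number (subpath 0 1 g) z"
    using winding_number_subpath_add[OF co, of 0 f 1] f z' by simp
  finally show ?thesis by simp
qed

text \<open>
  Up to the factor \<open>k\<close>, which rotates the slit starting at \<open>z\<close> to the negative real axis, the principal
  logarithm is a continuous choice of \<open>ln (\<gamma> t - z)\<close>, and the winding number is its increment.
\<close>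

lemma winding_number_slit_plane:
  fixes \<gamma> :: "real \<Rightarrow> complex"
  assumes "path \<gamma>" and k: "k \<noteq> 0"
    and slit: "\<And>t. t \<in> {0..1} \<Longrightarrow> k * (\<gamma> t - z) \<notin> \<real>\<^sub>\<le>\<^sub>0"
  shows "winding_number \<gamma> z
       = (Ln (k * (pathfinish \<gamma> - z)) - Ln (k * (pathstart \<gamma> - z))) / (2 * of_real pi * \<i>)"
proof -
  define q where "q = (\<lambda>t. Ln (k * (\<gamma> t - z)) - Ln k)"
  have "path q" unfolding path_def q_def
    using assms by (intro continuous_intros) (auto simp: path_def)
  have nz: "k * (\<gamma> t - z) \<noteq> 0" if "t \<in> {0..1}" for t
    using slit[OF that] by auto
  have ex: "exp (q t) = \<gamma> t - z" if "t \<in> {0..1}" for t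
    using nz[OF that] k by (simp add: q_def exp_diff)
  have "winding_number \<gamma> z = winding_number (\<lambda>t. \<gamma> t - z) 0"
    by (rule winding_number_offset)
  also have "\<dots> = winding_number (exp \<circ> q) 0"
    by (rule winding_number_cong) (simp add: ex)
  also have "\<dots> = (pathfinish q - pathstart q) / (2 * of_real pi * \<i>)"
    by (rule winding_number_compose_exp[OF \<open>path q\<close>])
  finally show ?thesis by (simp add: q_def pathfinish_def pathstart_def)
qed

section \<open>The jump of the winding number across an arc\<close>

lemma integer_valued_constant:
  fixes f :: "complex \<Rightarrow> complex"
  assumes "connected T" "continuous_on T f" and int: "\<And>z. z \<in> T \<Longrightarrow> f z \<in> \<int>"
    and "x \<in> T" "y \<in> T"
  shows "f x = f y"
proof -
  have "f constant_on T"
  proof (rule continuous_discrete_range_constant[OF assms(1,2)])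
    fix x assume "x \<in> T"
    have "1 \<le> norm (f y - f x)" if "y \<in> T" "f y \<noteq> f x" for y
      using int[OF \<open>x \<in> T\<close>] int[OF \<open>y \<in> T\<close>] that
      by (auto simp: Ints_def simp flip: of_int_diff)
    then show "\<exists>e>0. \<forall>y. y \<in> T \<and> f y \<noteq> f x \<longrightarrow> e \<le> norm (f y - f x)"
      by (metis zero_less_one)
  qed
  then show ?thesis using assms by (metis constant_on_def)
qed

text \<open>
  One side of the cone around the normal, with its apex removed. The last condition makes the apex
  drop out without spoiling convexity, so that an integer-valued continuous function is constant on it.
\<close>

lemma convex_cone_side:
  "convex {x. norm x < \<epsilon> \<and> \<rho> * norm x \<le> s * det2 u x \<and> 0 < s * det2 u x}" if "\<rho> > 0"
proof (rule convexI)
  fix x y :: complex and k l :: real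
  assume x: "x \<in> {x. norm x < \<epsilon> \<and> \<rho> * norm x \<le> s * det2 u x \<and> 0 < s * det2 u x}"
    and y: "y \<in> {x. norm x < \<epsilon> \<and> \<rho> * norm x \<le> s * det2 u x \<and> 0 < s * det2 u x}"
    and kl: "0 \<le> k" "0 \<le> l" "k + l = 1"
  have n: "norm (k *\<^sub>R x + l *\<^sub>R y) \<le> k * norm x + l * norm y"
    using kl by (metis abs_of_nonneg norm_scaleR norm_triangle_ineq)
  have d: "s * det2 u (k *\<^sub>R x + l *\<^sub>R y) = k * (s * det2 u x) + l * (s * det2 u y)"
    by (simp add: det2_add_right det2_scaleR_right algebra_simps)
  have 1: "k * norm x + l * norm y < \<epsilon>"
    using x y kl convex_bound_lt[of "norm x" \<epsilon> "norm y" k l] by auto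
  have "\<rho> * (k * norm x + l * norm y) = k * (\<rho> * norm x) + l * (\<rho> * norm y)"
    by (simp add: algebra_simps)
  also have "\<dots> \<le> k * (s * det2 u x) + l * (s * det2 u y)"
    using x y kl by (intro add_mono mult_left_mono) auto
  finally have 2: "\<rho> * norm (k *\<^sub>R x + l *\<^sub>R y) \<le> s * det2 u (k *\<^sub>R x + l *\<^sub>R y)"
    unfolding d using n \<open>\<rho> > 0\<close> by (smt (verit) mult_left_mono)
  have 3: "0 < k * (s * det2 u x) + l * (s * det2 u y)"
    using x y kl by (cases "k = 0") (auto intro!: add_pos_nonneg mult_pos_pos)
  show "k *\<^sub>R x + l *\<^sub>R y \<in> {x. norm x < \<epsilon> \<and> \<rho> * norm x \<le> s * det2 u x \<and> 0 < s * det2 u x}"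
    using n 1 2 3 d by auto
qed

text \<open>
  Only a short piece of the arc around \<open>p\<close> matters, since the winding number of the rest is continuous
  at \<open>p\<close>. Seen from a point on the normal just to the left of \<open>p\<close>, the short piece misses the ray pointing
  away from \<open>p\<close>, and likewise on the right. So both winding numbers are differences of logarithms; in
  the limit the arguments differ by a factor \<open>- 1\<close>, and the branches of the logarithm then
  contribute \<open>\<pi> \<i>\<close> at either end of the piece, in total \<open>2 \<pi> \<i>\<close>.
\<close>

lemma tendsto_arc_jump:
  fixes g :: "real \<Rightarrow> complex"
  assumes cont: "continuous_on {a..b} g" and t0: "a < t0" "t0 < b" and p: "g t0 = p"
    and simple: "\<And>t. t \<in> {a..b} \<Longrightarrow> g t = p \<Longrightarrow> t = t0"
    and der: "(g has_vector_derivative u) (at t0)" and "u \<noteq> 0"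
  shows "((\<lambda>e. winding_number (subpath a b g) (p + of_real e * (\<i> * u))
             - winding_number (subpath a b g) (p - of_real e * (\<i> * u))) \<longlongrightarrow> 1) (at_right 0)"
proof -
  obtain d where d: "d > 0"
    and win: "\<And>t. \<bar>t - t0\<bar> < d \<Longrightarrow> norm (g t - p - (t - t0) *\<^sub>R u) \<le> (norm u / 2) * \<bar>t - t0\<bar>"
    using tangent_window[OF der, of "norm u / 2"] \<open>u \<noteq> 0\<close> p by auto
  define \<delta> where "\<delta> = min (d / 2) (min (t0 - a) (b - t0) / 2)"
  have \<delta>: "\<delta> > 0" "\<delta> < d" "a < t0 - \<delta>" "t0 + \<delta> < b"
    using d t0 by (auto simp: \<delta>_def min_def field_simps)
  \<comment> \<open>In the coordinate \<open>h\<close> the point \<open>p\<close> is the origin and the velocity is \<open>1\<close>.\<close>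
  define h where "h = (\<lambda>t. (g t - p) / u)"
  have hb: "norm (h t - of_real (t - t0)) \<le> \<bar>t - t0\<bar> / 2" if "\<bar>t - t0\<bar> < d" for t
  proof -
    have "h t - of_real (t - t0) = (g t - p - (t - t0) *\<^sub>R u) / u"
      using \<open>u \<noteq> 0\<close> by (simp add: h_def scaleR_conv_of_real diff_divide_distrib)
    then have "norm (h t - of_real (t - t0)) = norm (g t - p - (t - t0) *\<^sub>R u) / norm u"
      by (simp only: norm_divide)
    also have "\<dots> \<le> ((norm u / 2) * \<bar>t - t0\<bar>) / norm u"
      by (rule divide_right_mono[OF win[OF that]]) simp
    also have "\<dots> = \<bar>t - t0\<bar> / 2" using \<open>u \<noteq> 0\<close> by simp
    finally show ?thesis .
  qed
  have Re_h: "\<bar>Re (h t) - (t - t0)\<bar> \<le> \<bar>t - t0\<bar> / 2" if "\<bar>t - t0\<bar> < d" for t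
    using hb[OF that] abs_Re_le_cmod[of "h t - of_real (t - t0)"] by simp
  define A where "A = h (t0 - \<delta>)"
  define B where "B = h (t0 + \<delta>)"
  have AB: "Re A < 0" "Re B > 0"
    using Re_h[of "t0 - \<delta>"] Re_h[of "t0 + \<delta>"] \<delta>
      abs_ge_self[of "Re A + \<delta>"] abs_ge_minus_self[of "Re B - \<delta>"] by (auto simp: A_def B_def)
  let ?\<sigma> = "subpath (t0 - \<delta>) (t0 + \<delta>) g"
  have cwin: "continuous_on {t0 - \<delta>..t0 + \<delta>} g" "continuous_on {a..t0 - \<delta>} g" "continuous_on {t0 + \<delta>..b} g"
     "continuous_on {a..t0 + \<delta>} g"
    using \<delta> by (auto intro!: continuous_on_subset[OF cont])
  \<comment> \<open>Seen from \<open>p + e i u\<close> (for \<open>s = 1\<close>) or \<open>p - e i u\<close> (for \<open>s = - 1\<close>), the short arc around \<open>p\<close>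
    avoids the ray that points away from \<open>p\<close>.\<close>
  have W\<sigma>: "winding_number ?\<sigma> (p + of_real (s * e) * (\<i> * u))
      = (Ln (of_real s * \<i> * B + of_real e) - Ln (of_real s * \<i> * A + of_real e)) / (2 * of_real pi * \<i>)"
    if s: "s = 1 \<or> s = -1" and e: "e > 0" for s e :: real
  proof -
    let ?z = "p + of_real (s * e) * (\<i> * u)" and ?k = "of_real s * \<i> / u"
    have k: "?k * (g t - ?z) = of_real s * \<i> * h t + of_real e" for t
      using s \<open>u \<noteq> 0\<close> by (auto simp: h_def field_simps)
    have "?k * (?\<sigma> t - ?z) \<notin> \<real>\<^sub>\<le>\<^sub>0" if "t \<in> {0..1}" for t
    proof
      define t' where "t' = (t0 + \<delta> - (t0 - \<delta>)) * t + (t0 - \<delta>)"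
      have "t' = 2 * (\<delta> * t) + (t0 - \<delta>)" by (simp add: t'_def)
      moreover have "0 \<le> \<delta> * t" "\<delta> * t \<le> \<delta>" using that \<delta> by auto
      ultimately have "t' - t0 \<le> \<delta>" "t0 - t' \<le> \<delta>" by linarith+
      then have t': "\<bar>t' - t0\<bar> < d" using \<delta>(2) by linarith
      assume "?k * (?\<sigma> t - ?z) \<in> \<real>\<^sub>\<le>\<^sub>0"
      then have *: "of_real s * \<i> * h t' + of_real e \<in> \<real>\<^sub>\<le>\<^sub>0"
        using k[of t'] by (simp add: subpath_def t'_def)
      then have "Re (h t') = 0" using s by (auto simp: complex_nonpos_Reals_iff)
      then have "t' = t0" using Re_h[OF t'] by (simp add: abs_if split: if_splits)
      then have "h t' = 0" by (simp add: h_def p)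
      then show False using * e by (simp add: complex_nonpos_Reals_iff)
    qed
    then have "winding_number ?\<sigma> ?z
        = (Ln (?k * (g (t0 + \<delta>) - ?z)) - Ln (?k * (g (t0 - \<delta>) - ?z))) / (2 * of_real pi * \<i>)"
      using winding_number_slit_plane[of ?\<sigma> ?k ?z] path_subpath_of_continuous[OF cwin(1)] \<delta> s \<open>u \<noteq> 0\<close>
      by auto
    then show ?thesis unfolding k A_def B_def .
  qed
  have lim: "((\<lambda>e. winding_number ?\<sigma> (p + of_real (s * e) * (\<i> * u))) \<longlongrightarrow>
      (Ln (of_real s * \<i> * B) - Ln (of_real s * \<i> * A)) / (2 * of_real pi * \<i>)) (at_right 0)"
    if s: "s = 1 \<or> s = -1" for s :: real
  proof (rule Lim_transform_eventually)
    have nn: "of_real s * \<i> * B + of_real 0 \<notin> \<real>\<^sub>\<le>\<^sub>0" "of_real s * \<i> * A + of_real 0 \<notin> \<real>\<^sub>\<le>\<^sub>0"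
      using AB s by (auto simp: complex_nonpos_Reals_iff)
    have "((\<lambda>e. (Ln (of_real s * \<i> * B + of_real e) - Ln (of_real s * \<i> * A + of_real e)) / (2 * of_real pi * \<i>))
        \<longlongrightarrow> (Ln (of_real s * \<i> * B + of_real 0) - Ln (of_real s * \<i> * A + of_real 0)) / (2 * of_real pi * \<i>)) (at_right 0)"
      by (intro tendsto_intros nn) auto
    then show "((\<lambda>e. (Ln (of_real s * \<i> * B + of_real e) - Ln (of_real s * \<i> * A + of_real e)) / (2 * of_real pi * \<i>))
        \<longlongrightarrow> (Ln (of_real s * \<i> * B) - Ln (of_real s * \<i> * A)) / (2 * of_real pi * \<i>)) (at_right 0)"
      by simp
    show "\<forall>\<^sub>F e in at_right 0. (Ln (of_real s * \<i> * B + of_real e) - Ln (of_real s * \<i> * A + of_real e)) / (2 * of_real pi * \<i>)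
        = winding_number ?\<sigma> (p + of_real (s * e) * (\<i> * u))"
      using W\<sigma>[OF s] by (auto simp: eventually_at_right_field intro!: exI[of _ 1])
  qed
  have val: "(Ln (of_real 1 * \<i> * B) - Ln (of_real 1 * \<i> * A)) / (2 * of_real pi * \<i>)
      - (Ln (of_real (-1) * \<i> * B) - Ln (of_real (-1) * \<i> * A)) / (2 * of_real pi * \<i>) = 1"
  proof -
    have "Ln (- (\<i> * B)) = Ln (\<i> * B) - \<i> * of_real pi"
      using AB by (subst Ln_minus) auto
    moreover have "Ln (- (\<i> * A)) = Ln (\<i> * A) + \<i> * of_real pi"
      using AB by (subst Ln_minus) auto
    ultimately show ?thesis by (simp add: field_simps)
  qed
  define G where "G = (\<lambda>z. winding_number (subpath a (t0 - \<delta>) g) z + winding_number (subpath (t0 + \<delta>) b g) z)"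
  have "p \<notin> g ` {a..t0 - \<delta>}" "p \<notin> g ` {t0 + \<delta>..b}"
  proof -
    have "p \<notin> g ` T" if "T \<subseteq> {a..b} - {t0}" for T using simple that by blast
    from this[of "{a..t0 - \<delta>}"] this[of "{t0 + \<delta>..b}"]
    show "p \<notin> g ` {a..t0 - \<delta>}" "p \<notin> g ` {t0 + \<delta>..b}"
      using \<delta> t0 by (simp_all add: subset_iff)
  qed
  then have "isCont (winding_number (subpath a (t0 - \<delta>) g)) p" "isCont (winding_number (subpath (t0 + \<delta>) b g)) p"
    using \<delta> cwin by (auto intro!: continuous_at_winding_number path_subpath_of_continuous simp: path_image_subpath)
  then have "isCont G p" unfolding G_def by (intro continuous_intros)
  then have limG: "((\<lambda>e. G (p + of_real (s * e) * (\<i> * u))) \<longlongrightarrow> G p) (at_right 0)" for s :: real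
  proof (rule isCont_tendsto_compose)
    have "((\<lambda>e. p + of_real (s * e) * (\<i> * u)) \<longlongrightarrow> p + of_real (s * 0) * (\<i> * u)) (at_right 0)"
      by (intro tendsto_intros)
    then show "((\<lambda>e. p + of_real (s * e) * (\<i> * u)) \<longlongrightarrow> p) (at_right 0)" by simp
  qed
  obtain \<epsilon> where \<epsilon>: "\<epsilon> > 0"
    and av: "\<And>x. \<lbrakk>x \<noteq> 0; norm x < \<epsilon>; (norm u) * norm x \<le> \<bar>det2 u x\<bar>\<rbrakk> \<Longrightarrow> p + x \<notin> g ` {a..b}"
    using cone_avoids_arc[OF cont p simple der \<open>u \<noteq> 0\<close>, of "norm u"] \<open>u \<noteq> 0\<close> by auto
  have split: "winding_number (subpath a b g) z = G z + winding_number ?\<sigma> z" if "z \<notin> g ` {a..b}" for z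
  proof -
    have "z \<notin> g ` {a..t0 + \<delta>}" using that \<delta> by auto
    then show ?thesis
      using winding_number_subpath_add[OF cont, of "t0 + \<delta>" z]
        winding_number_subpath_add[OF cwin(4), of "t0 - \<delta>" z] \<delta> that
      by (simp add: G_def)
  qed
  have sp: "G (p + of_real (s * e) * (\<i> * u)) + winding_number ?\<sigma> (p + of_real (s * e) * (\<i> * u))
      = winding_number (subpath a b g) (p + of_real (s * e) * (\<i> * u))"
    if s: "s = 1 \<or> s = -1" and e: "e > 0" "e < \<epsilon> / norm u" for s e :: real
  proof (rule split[symmetric], rule av)
    show "of_real (s * e) * (\<i> * u) \<noteq> 0" using s e \<open>u \<noteq> 0\<close> by auto
    show "norm (of_real (s * e) * (\<i> * u)) < \<epsilon>"
      using s e \<open>u \<noteq> 0\<close> by (auto simp: norm_mult field_simps)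
    have "det2 u (of_real (s * e) * (\<i> * u)) = s * e * (norm u)\<^sup>2"
      unfolding cmod_power2 by (simp add: det2_def algebra_simps power2_eq_square)
    then show "norm u * norm (of_real (s * e) * (\<i> * u)) \<le> \<bar>det2 u (of_real (s * e) * (\<i> * u))\<bar>"
      using s e by (auto simp: norm_mult power2_eq_square abs_mult)
  qed
  have both: "((\<lambda>e. winding_number (subpath a b g) (p + of_real (s * e) * (\<i> * u))) \<longlongrightarrow>
      G p + (Ln (of_real s * \<i> * B) - Ln (of_real s * \<i> * A)) / (2 * of_real pi * \<i>)) (at_right 0)"
    if s: "s = 1 \<or> s = -1" for s :: real
  proof (rule Lim_transform_eventually[OF tendsto_add[OF limG[of s] lim[OF s]]])
    have "\<epsilon> / norm u > 0" using \<epsilon> \<open>u \<noteq> 0\<close> by simp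
    then show "\<forall>\<^sub>F e in at_right 0. G (p + of_real (s * e) * (\<i> * u)) + winding_number ?\<sigma> (p + of_real (s * e) * (\<i> * u))
      = winding_number (subpath a b g) (p + of_real (s * e) * (\<i> * u))"
      using sp[OF s] unfolding eventually_at_right_field by blast
  qed
  have "((\<lambda>e. winding_number (subpath a b g) (p + of_real (1 * e) * (\<i> * u))
             - winding_number (subpath a b g) (p + of_real ((-1) * e) * (\<i> * u)))
      \<longlongrightarrow> (G p + (Ln (of_real 1 * \<i> * B) - Ln (of_real 1 * \<i> * A)) / (2 * of_real pi * \<i>))
        - (G p + (Ln (of_real (-1) * \<i> * B) - Ln (of_real (-1) * \<i> * A)) / (2 * of_real pi * \<i>))) (at_right 0)"
    by (intro tendsto_diff both) auto
  moreover have "(G p + (Ln (of_real 1 * \<i> * B) - Ln (of_real 1 * \<i> * A)) / (2 * of_real pi * \<i>))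
        - (G p + (Ln (of_real (-1) * \<i> * B) - Ln (of_real (-1) * \<i> * A)) / (2 * of_real pi * \<i>)) = 1"
    using val by (simp add: algebra_simps)
  ultimately show ?thesis by simp
qed

text \<open>
  The function \<open>V\<close>, defined off the set \<open>A\<close>, takes the values \<open>n\<close> to the right and \<open>n + 1\<close> to the left of
  the direction \<open>u\<close> at \<open>p\<close>. The radius in which this holds may depend on the angle \<open>\<rho>\<close> to be kept from the
  line spanned by \<open>u\<close>, because \<open>A\<close> need not be straight.
\<close>

definition jumps_across ::
    "(complex \<Rightarrow> complex) \<Rightarrow> complex set \<Rightarrow> complex \<Rightarrow> complex \<Rightarrow> complex \<Rightarrow> bool" where
  "jumps_across V A p u n \<longleftrightarrow>
     (\<forall>\<rho>>0. \<exists>\<epsilon>>0. \<forall>x. x \<noteq> 0 \<longrightarrow> norm x < \<epsilon> \<longrightarrow> \<rho> * norm x \<le> \<bar>det2 u x\<bar> \<longrightarrow>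
        p + x \<notin> A \<and> V (p + x) = n + of_bool (det2 u x > 0))"

text \<open>
  The summand \<open>F\<close> stands for whatever closes the arc to a loop away from \<open>p\<close>. It makes the sum \<open>W + F\<close>
  integer-valued, hence constant on each side of every small cone around the normal; all these cones
  share points of the normal, where the difference of the two values tends to \<open>1\<close>.
\<close>

theorem winding_number_jumps_across_arc:
  fixes g :: "real \<Rightarrow> complex"
  assumes cont: "continuous_on {a..b} g" and t0: "a < t0" "t0 < b" and p: "g t0 = p"
    and simple: "\<And>t. t \<in> {a..b} \<Longrightarrow> g t = p \<Longrightarrow> t = t0"
    and der: "(g has_vector_derivative u) (at t0)" and "u \<noteq> 0"
    and U: "open U" "p \<in> U" and contF: "continuous_on U F"
    and int: "\<And>z. z \<in> U \<Longrightarrow> z \<notin> g ` {a..b} \<Longrightarrow> winding_number (subpath a b g) z + F z \<in> \<int>"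
  obtains n where
    "jumps_across (\<lambda>z. winding_number (subpath a b g) z + F z) (g ` {a..b}) p u n"
proof -
  let ?A = "g ` {a..b}" and ?W = "winding_number (subpath a b g)"
  define V where "V = (\<lambda>z. ?W z + F z)"
  have path: "path (subpath a b g)" "path_image (subpath a b g) = ?A"
    using path_subpath_of_continuous[OF cont] t0 by (auto simp: path_image_subpath)
  have contV: "continuous_on (U - ?A) V" unfolding V_def
    by (intro continuous_intros continuous_on_subset[OF contF]
          continuous_on_subset[OF continuous_on_winding_number[OF path(1)]]) (auto simp: path(2))
  have cone: "\<exists>\<epsilon>>0. \<forall>x. x \<noteq> 0 \<longrightarrow> norm x < \<epsilon> \<longrightarrow> \<rho> * norm x \<le> \<bar>det2 u x\<bar> \<longrightarrow> p + x \<in> U - ?A"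
    if "\<rho> > 0" for \<rho>
  proof -
    obtain \<epsilon>1 where \<epsilon>1: "\<epsilon>1 > 0"
      "\<And>x. \<lbrakk>x \<noteq> 0; norm x < \<epsilon>1; \<rho> * norm x \<le> \<bar>det2 u x\<bar>\<rbrakk> \<Longrightarrow> p + x \<notin> ?A"
      using cone_avoids_arc[OF cont p simple der \<open>u \<noteq> 0\<close> \<open>\<rho> > 0\<close>] by blast
    obtain \<epsilon>2 where \<epsilon>2: "\<epsilon>2 > 0" "ball p \<epsilon>2 \<subseteq> U" using U by (meson openE)
    have "p + x \<in> U" if "norm x < \<epsilon>2" for x
      using \<epsilon>2(2) that by (auto simp: subset_iff dist_norm)
    then show ?thesis using \<epsilon>1 \<epsilon>2 by (intro exI[of _ "min \<epsilon>1 \<epsilon>2"]) auto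
  qed
  have const: "V (p + x) = V (p + y)"
    if \<rho>: "\<rho> > 0" and \<epsilon>: "\<And>x. x \<noteq> 0 \<Longrightarrow> norm x < \<epsilon> \<Longrightarrow> \<rho> * norm x \<le> \<bar>det2 u x\<bar> \<Longrightarrow> p + x \<in> U - ?A"
      and x: "norm x < \<epsilon>" "\<rho> * norm x \<le> s * det2 u x" "0 < s * det2 u x"
      and y: "norm y < \<epsilon>" "\<rho> * norm y \<le> s * det2 u y" "0 < s * det2 u y"
      and s: "s = 1 \<or> s = -1" for \<rho> \<epsilon> s x y
  proof -
    let ?K = "(+) p ` {x. norm x < \<epsilon> \<and> \<rho> * norm x \<le> s * det2 u x \<and> 0 < s * det2 u x}"
    have K: "?K \<subseteq> U - ?A"
    proof (rule image_subsetI)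
      fix x assume x: "x \<in> {x. norm x < \<epsilon> \<and> \<rho> * norm x \<le> s * det2 u x \<and> 0 < s * det2 u x}"
      then have "x \<noteq> 0" by (auto simp: det2_def)
      then show "p + x \<in> U - ?A" using x s by (intro \<epsilon>) auto
    qed
    show ?thesis
    proof (rule integer_valued_constant[where f = V and T = ?K])
      show "connected ?K"
        using convex_cone_side[OF \<rho>, of \<epsilon> s u] by (intro convex_connected convex_translation)
      show "continuous_on ?K V" by (rule continuous_on_subset[OF contV K])
      show "V z \<in> \<int>" if "z \<in> ?K" for z using int K that by (auto simp: V_def)
    qed (use x y in auto)
  qed
  have det_iu: "det2 u (of_real r * (\<i> * u)) = r * (norm u)\<^sup>2" for r
    unfolding cmod_power2 by (simp add: det2_def algebra_simps power2_eq_square)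
  have in_cone: "\<rho> * norm (of_real (s * e) * (\<i> * u)) \<le> s * det2 u (of_real (s * e) * (\<i> * u))"
    "0 < s * det2 u (of_real (s * e) * (\<i> * u))"
    if "s = 1 \<or> s = -1" "e > 0" "\<rho> \<le> norm u" for s e \<rho> :: real
  proof -
    have "s * det2 u (of_real (s * e) * (\<i> * u)) = e * (norm u)\<^sup>2"
      unfolding det_iu using that by auto
    moreover have "\<rho> * norm (of_real (s * e) * (\<i> * u)) = e * (\<rho> * norm u)"
      using that by (auto simp: norm_mult)
    moreover have "\<rho> * norm u \<le> (norm u)\<^sup>2"
      using that by (simp add: power2_eq_square mult_right_mono)
    ultimately show "\<rho> * norm (of_real (s * e) * (\<i> * u)) \<le> s * det2 u (of_real (s * e) * (\<i> * u))"
      "0 < s * det2 u (of_real (s * e) * (\<i> * u))"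
      using that \<open>u \<noteq> 0\<close> by (auto intro!: mult_left_mono)
  qed
  have small: "\<forall>\<^sub>F e in at_right 0. norm (of_real (s * e) * (\<i> * u)) < \<epsilon>"
    if "s = 1 \<or> s = -1" "\<epsilon> > 0" for s \<epsilon> :: real
  proof -
    have "((\<lambda>e. norm (of_real (s * e) * (\<i> * u))) \<longlongrightarrow> norm (of_real (s * 0) * (\<i> * u))) (at_right 0)"
      by (intro tendsto_intros)
    then show ?thesis using that(2) by (auto elim!: order_tendstoD)
  qed
  have pos: "\<forall>\<^sub>F e in at_right (0::real). e > 0" by (simp add: eventually_at_right_less)
  \<comment> \<open>The reference values, on the normal through \<open>p\<close>.\<close>
  obtain \<epsilon>0 where \<epsilon>0: "\<epsilon>0 > 0"
    "\<And>x. x \<noteq> 0 \<Longrightarrow> norm x < \<epsilon>0 \<Longrightarrow> norm u * norm x \<le> \<bar>det2 u x\<bar> \<Longrightarrow> p + x \<in> U - ?A"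
    using cone[of "norm u"] \<open>u \<noteq> 0\<close> by auto
  note sm = small[OF _ \<epsilon>0(1)]
  have "\<forall>\<^sub>F e in at_right 0. norm (of_real (1 * e) * (\<i> * u)) < \<epsilon>0 \<and> norm (of_real ((-1) * e) * (\<i> * u)) < \<epsilon>0 \<and> e > 0"
    using small[of 1 \<epsilon>0] small[of "-1" \<epsilon>0] pos \<epsilon>0 by (auto simp: eventually_conj_iff)
  then obtain e0 where e0: "e0 > 0" "\<And>s. s = 1 \<or> s = -1 \<Longrightarrow> norm (of_real (s * e0) * (\<i> * u)) < \<epsilon>0"
    using eventually_happens'[OF trivial_limit_at_right_real] by blast
  define n where "n = V (p + of_real ((-1) * e0) * (\<i> * u))"
  have norm_const: "V (p + of_real (s * e) * (\<i> * u)) = V (p + of_real (s * e0) * (\<i> * u))"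
    if "s = 1 \<or> s = -1" "e > 0" "norm (of_real (s * e) * (\<i> * u)) < \<epsilon>0" for s e
    using const[of "norm u" \<epsilon>0 "of_real (s * e) * (\<i> * u)" s "of_real (s * e0) * (\<i> * u)", OF _ \<epsilon>0(2)]
      in_cone[of s e "norm u"] in_cone[of s e0 "norm u"] that e0 \<open>u \<noteq> 0\<close> by auto
  have jump: "V (p + of_real (1 * e0) * (\<i> * u)) = n + 1"
  proof -
    let ?c = "V (p + of_real (1 * e0) * (\<i> * u)) - n"
    have "isCont F p" using contF U by (simp add: continuous_on_eq_continuous_at)
    have "((\<lambda>e. F (p + of_real (s * e) * (\<i> * u))) \<longlongrightarrow> F p) (at_right 0)" for s
    proof (rule isCont_tendsto_compose[OF \<open>isCont F p\<close>])
      have "((\<lambda>e. p + of_real (s * e) * (\<i> * u)) \<longlongrightarrow> p + of_real (s * 0) * (\<i> * u)) (at_right 0)"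
        by (intro tendsto_intros)
      then show "((\<lambda>e. p + of_real (s * e) * (\<i> * u)) \<longlongrightarrow> p) (at_right 0)" by simp
    qed
    from tendsto_diff[OF this[of 1] this[of "-1"]]
    have "((\<lambda>e. F (p + of_real e * (\<i> * u)) - F (p - of_real e * (\<i> * u))) \<longlongrightarrow> 0) (at_right 0)"
      by simp
    from tendsto_add[OF tendsto_arc_jump[OF cont t0 p simple der \<open>u \<noteq> 0\<close>] this]
    have "((\<lambda>e. V (p + of_real e * (\<i> * u)) - V (p - of_real e * (\<i> * u))) \<longlongrightarrow> 1) (at_right 0)"
      by (simp add: V_def algebra_simps)
    moreover have "\<forall>\<^sub>F e in at_right 0. V (p + of_real e * (\<i> * u)) - V (p - of_real e * (\<i> * u)) = ?c"
      using sm[of 1, simplified] sm[of "-1", simplified] pos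
      by eventually_elim (use \<epsilon>0 norm_const[of 1] norm_const[of "-1"] in \<open>auto simp: n_def\<close>)
    ultimately have "((\<lambda>e::real. ?c) \<longlongrightarrow> 1) (at_right 0)"
      by (rule Lim_transform_eventually)
    then have "?c = 1" by (simp add: tendsto_const_iff)
    then show ?thesis by (simp add: algebra_simps)
  qed
  have "jumps_across V ?A p u n"
    unfolding jumps_across_def
  proof (intro allI impI)
    fix \<rho> :: real assume "\<rho> > 0"
    \<comment> \<open>Shrinking \<open>\<rho>\<close> widens the cone so that it contains the normal.\<close>
    define \<rho>' where "\<rho>' = min \<rho> (norm u)"
    have \<rho>': "\<rho>' > 0" "\<rho>' \<le> \<rho>" "\<rho>' \<le> norm u" using \<open>\<rho> > 0\<close> \<open>u \<noteq> 0\<close> by (auto simp: \<rho>'_def)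
    obtain \<epsilon> where \<epsilon>: "\<epsilon> > 0"
      "\<And>x. x \<noteq> 0 \<Longrightarrow> norm x < \<epsilon> \<Longrightarrow> \<rho>' * norm x \<le> \<bar>det2 u x\<bar> \<Longrightarrow> p + x \<in> U - ?A"
      using cone[OF \<rho>'(1)] by blast
    show "\<exists>\<epsilon>>0. \<forall>x. x \<noteq> 0 \<longrightarrow> norm x < \<epsilon> \<longrightarrow> \<rho> * norm x \<le> \<bar>det2 u x\<bar> \<longrightarrow>
        p + x \<notin> ?A \<and> V (p + x) = n + of_bool (det2 u x > 0)"
    proof (intro exI[of _ \<epsilon>] conjI allI impI \<epsilon>(1))
      fix x assume x: "x \<noteq> 0" "norm x < \<epsilon>" "\<rho> * norm x \<le> \<bar>det2 u x\<bar>"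
      have x': "\<rho>' * norm x \<le> \<bar>det2 u x\<bar>"
        using \<rho>'(2) x(3) by (smt (verit) mult_right_mono norm_ge_zero)
      show "p + x \<notin> ?A" using \<epsilon>(2)[OF x(1,2) x'] by blast
      have "\<rho> * norm x > 0" using \<open>\<rho> > 0\<close> x by simp
      then have nz: "det2 u x \<noteq> 0" using x by auto
      define s where "s = sgn (det2 u x)"
      have s: "s = 1 \<or> s = -1" using nz by (auto simp: s_def sgn_if)
      have sx: "s * det2 u x = \<bar>det2 u x\<bar>" by (simp add: s_def sgn_if)
      have "\<forall>\<^sub>F e in at_right 0. norm (of_real (s * e) * (\<i> * u)) < min \<epsilon> \<epsilon>0 \<and> e > 0"
        using small[OF s, of "min \<epsilon> \<epsilon>0"] pos \<epsilon>0 \<epsilon> by (auto simp: eventually_conj_iff)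
      then obtain e where e: "e > 0" "norm (of_real (s * e) * (\<i> * u)) < min \<epsilon> \<epsilon>0"
        using eventually_happens'[OF trivial_limit_at_right_real] by blast
      have "V (p + x) = V (p + of_real (s * e) * (\<i> * u))"
        using const[of \<rho>' \<epsilon> x s "of_real (s * e) * (\<i> * u)", OF \<rho>'(1) \<epsilon>(2)] in_cone[OF s e(1) \<rho>'(3)] s x x' sx e nz
        by auto
      also have "\<dots> = V (p + of_real (s * e0) * (\<i> * u))"
        using norm_const[OF s e(1)] e by simp
      also have "\<dots> = n + of_bool (det2 u x > 0)"
        using s jump nz by (auto simp: s_def sgn_if n_def split: if_splits)
      finally show "V (p + x) = n + of_bool (det2 u x > 0)" .
    qed
  qed
  then show thesis using that by (simp add: V_def)
qed

text \<open>
  A curve that passes transversally through \<open>p\<close> stays in a cone that avoids the direction \<open>u\<close>, so it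
  goes from one side to the other.
\<close>

lemma jumps_across_curve:
  assumes jump: "jumps_across V A p u n" and z: "(z has_vector_derivative w) (at \<tau>)" "z \<tau> = p"
    and det: "det2 u w \<noteq> 0"
  shows "\<forall>\<^sub>F t in at_right \<tau>. z t \<notin> A \<and> V (z t) = n + of_bool (det2 u w > 0)"
    and "\<forall>\<^sub>F t in at_left \<tau>. z t \<notin> A \<and> V (z t) = n + of_bool (det2 u w < 0)"
proof -
  have u: "norm u > 0" using det by (auto simp: det2_def)
  define \<eta> where "\<eta> = \<bar>det2 u w\<bar> / (2 * norm u)"
  have \<eta>: "\<eta> > 0" using det u by (simp add: \<eta>_def)
  obtain d where d: "d > 0"
    "\<And>t. \<bar>t - \<tau>\<bar> < d \<Longrightarrow> norm (z t - p - (t - \<tau>) *\<^sub>R w) \<le> \<eta> * \<bar>t - \<tau>\<bar>"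
    using tangent_window[OF z(1) \<eta>] z(2) by metis
  define L where "L = norm w + \<eta>"
  have w\<eta>: "L > 0" using \<eta> by (simp add: L_def add_nonneg_pos)
  define \<rho> where "\<rho> = \<bar>det2 u w\<bar> / (2 * L)"
  then have \<rho>: "\<rho> > 0" using det w\<eta> by (simp add: \<rho>_def)
  obtain \<epsilon> where \<epsilon>: "\<epsilon> > 0" "\<And>x. \<lbrakk>x \<noteq> 0; norm x < \<epsilon>; \<rho> * norm x \<le> \<bar>det2 u x\<bar>\<rbrakk> \<Longrightarrow>
      p + x \<notin> A \<and> V (p + x) = n + of_bool (det2 u x > 0)"
    using jump \<rho> unfolding jumps_across_def by metis
  define d' where "d' = min d (\<epsilon> / L)"
  have d': "d' > 0" using d \<epsilon> w\<eta> by (simp add: d'_def)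
  have key: "z t \<notin> A \<and> V (z t) = n + of_bool ((t - \<tau>) * det2 u w > 0)"
    if t: "t \<noteq> \<tau>" "\<bar>t - \<tau>\<bar> < d'" for t
  proof -
    define x where "x = z t - p"
    define r where "r = x - (t - \<tau>) *\<^sub>R w"
    have xr: "x = (t - \<tau>) *\<^sub>R w + r" by (simp add: r_def)
    have r: "norm r \<le> \<eta> * \<bar>t - \<tau>\<bar>" using d(2)[of t] t by (simp add: r_def x_def d'_def)
    have "\<bar>det2 u r\<bar> \<le> norm u * (\<eta> * \<bar>t - \<tau>\<bar>)"
      using abs_det2_le[of u r] r u by (smt (verit) mult_left_mono)
    also have "\<dots> = \<bar>(t - \<tau>) * det2 u w\<bar> / 2"
      using u by (simp add: \<eta>_def abs_mult)
    finally have dr: "\<bar>det2 u r\<bar> \<le> \<bar>(t - \<tau>) * det2 u w\<bar> / 2" .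
    have dx: "det2 u x = (t - \<tau>) * det2 u w + det2 u r"
      by (simp add: xr det2_add_right det2_scaleR_right)
    have nz: "(t - \<tau>) * det2 u w \<noteq> 0" using t det by simp
    have "P + Q \<noteq> 0 \<and> \<bar>P\<bar> / 2 \<le> \<bar>P + Q\<bar> \<and> (P + Q > 0 \<longleftrightarrow> P > 0)"
      if "\<bar>Q\<bar> \<le> \<bar>P\<bar> / 2" "P \<noteq> 0" for P Q :: real
      using that by (auto simp: abs_if split: if_splits)
    from this[OF dr nz]
    have dom: "det2 u x \<noteq> 0" "\<bar>(t - \<tau>) * det2 u w\<bar> / 2 \<le> \<bar>det2 u x\<bar>"
      "det2 u x > 0 \<longleftrightarrow> (t - \<tau>) * det2 u w > 0"
      unfolding dx by blast+
    have "norm x \<le> \<bar>t - \<tau>\<bar> * norm w + \<eta> * \<bar>t - \<tau>\<bar>"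
      using norm_triangle_ineq[of "(t - \<tau>) *\<^sub>R w" r] r by (simp add: xr)
    then have nx: "norm x \<le> \<bar>t - \<tau>\<bar> * L" by (simp add: L_def algebra_simps)
    also have "\<dots> < \<epsilon>" using t w\<eta> by (simp add: d'_def field_simps)
    finally have "norm x < \<epsilon>" .
    moreover have "x \<noteq> 0" using dom(1) by (auto simp: det2_def)
    moreover have "\<rho> * norm x \<le> \<bar>det2 u x\<bar>"
    proof -
      have "\<rho> * norm x \<le> \<rho> * (\<bar>t - \<tau>\<bar> * L)" using nx \<rho> by simp
      also have "\<dots> = \<bar>(t - \<tau>) * det2 u w\<bar> / 2" using w\<eta> by (simp add: \<rho>_def abs_mult)
      also have "\<dots> \<le> \<bar>det2 u x\<bar>" by (rule dom(2))
      finally show ?thesis .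
    qed
    ultimately have "p + x \<notin> A \<and> V (p + x) = n + of_bool (det2 u x > 0)" by (intro \<epsilon>(2))
    then show ?thesis using dom(3) by (simp add: x_def)
  qed
  show "\<forall>\<^sub>F t in at_right \<tau>. z t \<notin> A \<and> V (z t) = n + of_bool (det2 u w > 0)"
    unfolding eventually_at_right_field using d' key
    by (intro exI[of _ "\<tau> + d'"]) (auto simp: zero_less_mult_iff)
  show "\<forall>\<^sub>F t in at_left \<tau>. z t \<notin> A \<and> V (z t) = n + of_bool (det2 u w < 0)"
    unfolding eventually_at_left_field using d' key
    by (intro exI[of _ "\<tau> - d'"]) (auto simp: zero_less_mult_iff)
qed

section \<open>Crossings of a knot diagram\<close>

locale diagram =
  fixes D :: knot_diagram
  assumes diagram: "is_knot_diagram D"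
begin

lemma curve_period: "curve D (t + of_int k) = curve D t"
proof (induction k rule: int_induct[where k = 0])
  case (step1 i)
  then show ?case using diagram unfolding is_knot_diagram_def
    by (metis (no_types, opaque_lifting) add.assoc of_int_1 of_int_add)
next
  case (step2 i)
  then show ?case using diagram unfolding is_knot_diagram_def
    by (metis (no_types, opaque_lifting) add.assoc diff_add_cancel of_int_1 of_int_add)
qed simp

lemma overpass_period: "t + of_int k \<in> overpass D \<longleftrightarrow> t \<in> overpass D"
proof (induction k rule: int_induct[where k = 0])
  case (step1 i)
  then show ?case using diagram unfolding is_knot_diagram_def
    by (metis (no_types, opaque_lifting) add.assoc of_int_1 of_int_add)
next
  case (step2 i)
  then show ?case using diagram unfolding is_knot_diagram_def
    by (metis (no_types, opaque_lifting) add.assoc diff_add_cancel of_int_1 of_int_add)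
qed simp

lemma has_tangent: "(curve D has_vector_derivative tangent D t) (at t)"
  using diagram unfolding is_knot_diagram_def tangent_def C1_differentiable_on_def
  by (metis UNIV_I vector_derivative_at)

lemma tangent_eqI: "(curve D has_vector_derivative w) (at t) \<Longrightarrow> tangent D t = w"
  using has_tangent vector_derivative_unique_at by blast

lemma tangent_period: "tangent D (t + of_int k) = tangent D t"
proof (rule tangent_eqI[symmetric])
  have "((\<lambda>x. x + real_of_int k) has_vector_derivative 1) (at t)"
    using has_vector_derivative_add[OF has_vector_derivative_id has_vector_derivative_const] by simp
  then have "((\<lambda>x. curve D (x + of_int k)) has_vector_derivative tangent D (t + of_int k)) (at t)"
    using vector_diff_chain_at[of "\<lambda>x. x + of_int k" 1 t "curve D" "tangent D (t + of_int k)"]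
      has_tangent[of "t + of_int k"]
    by (simp add: o_def)
  then show "(curve D has_vector_derivative tangent D (t + of_int k)) (at t)"
    by (simp add: curve_period)
qed

lemma tangent_nonzero: "tangent D t \<noteq> 0"
  using diagram by (auto simp: is_knot_diagram_def)

lemma continuous_curve: "continuous_on S (curve D)"
  by (intro continuous_at_imp_continuous_on ballI has_vector_derivative_continuous[OF has_tangent])

lemma same_point_times:
  "curve D r = curve D s \<Longrightarrow> curve D s = curve D t \<Longrightarrow> r - s \<in> \<int> \<or> s - t \<in> \<int> \<or> r - t \<in> \<int>"
  using diagram by (auto simp: is_knot_diagram_def)

lemma transverse: "double_times D s t \<Longrightarrow> det2 (tangent D s) (tangent D t) \<noteq> 0"
  using diagram by (auto simp: is_knot_diagram_def)

lemma overpass_iff: "double_times D s t \<Longrightarrow> s \<in> overpass D \<longleftrightarrow> t \<notin> overpass D"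
  using diagram by (auto simp: is_knot_diagram_def)

lemma finite_crossings: "finite (crossings D)"
  using diagram by (auto simp: is_knot_diagram_def)

lemma curve_congr: "s - t \<in> \<int> \<Longrightarrow> curve D s = curve D t"
  and tangent_congr: "s - t \<in> \<int> \<Longrightarrow> tangent D s = tangent D t"
  and overpass_congr: "s - t \<in> \<int> \<Longrightarrow> s \<in> overpass D \<longleftrightarrow> t \<in> overpass D"
proof -
  assume "s - t \<in> \<int>"
  then obtain k where "s - t = of_int k" by (auto simp: Ints_def)
  then have "s = t + of_int k" by simp
  then show "curve D s = curve D t" "tangent D s = tangent D t" "s \<in> overpass D \<longleftrightarrow> t \<in> overpass D"
    using curve_period tangent_period overpass_period by auto
qed

lemma double_times_sym: "double_times D s t \<longleftrightarrow> double_times D t s"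
  by (auto simp: double_times_def Ints_minus minus_diff_eq dest: Ints_minus)

lemma range_curve_period: "range (curve D) = curve D ` {a..a + 1}"
proof
  show "range (curve D) \<subseteq> curve D ` {a..a + 1}"
  proof (rule image_subsetI)
    fix t
    have "t - (a + frac (t - a)) \<in> \<int>" by (simp add: frac_def)
    then have "curve D t = curve D (a + frac (t - a))" by (rule curve_congr)
    then show "curve D t \<in> curve D ` {a..a + 1}"
      using frac_lt_1[of "t - a"] frac_ge_0[of "t - a"] by (auto intro!: image_eqI less_imp_le)
  qed
qed auto

lemma path_curve: "path (curve D)" "pathfinish (curve D) = pathstart (curve D)"
    "path_image (curve D) = range (curve D)"
  using continuous_curve curve_period[of 0 1] range_curve_period[of 0]
  by (auto simp: path_def pathfinish_def pathstart_def path_image_def)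

lemma over_under_time:
  assumes dt: "double_times D s t" and over: "s \<in> overpass D"
  shows "over_time D (curve D s) = frac s" and "under_time D (curve D s) = frac t"
proof -
  have st: "curve D s = curve D t" "s - t \<notin> \<int>" "t \<notin> overpass D"
    using dt over overpass_iff by (auto simp: double_times_def)
  have fr: "frac r - r \<in> \<int>" for r :: real by (simp add: frac_def)
  have uniq: "r = frac s \<or> r = frac t" if "r \<in> {0..<1}" "curve D r = curve D s" for r
  proof -
    have "r - s \<in> \<int> \<or> r - t \<in> \<int>" using same_point_times[OF that(2) st(1)] st by blast
    then have "s - r \<in> \<int> \<or> t - r \<in> \<int>" by (metis Ints_minus minus_diff_eq)
    then show ?thesis using that(1) frac_unique_iff[of s r] frac_unique_iff[of t r] by auto
  qed
  have in01: "frac r \<in> {0..<1}" for r :: real by (simp add: frac_lt_1)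
  note cs = curve_congr[OF fr] overpass_congr[OF fr]
  show "over_time D (curve D s) = frac s" unfolding over_time_def
    using uniq in01 cs st over by (intro the_equality) auto
  show "under_time D (curve D s) = frac t" unfolding under_time_def
    using uniq in01 cs st over by (intro the_equality) auto
qed

lemma crossing_sign_eq:
  assumes "double_times D s t" "s \<in> overpass D"
  shows "crossing_sign D (curve D s) = sgn (det2 (tangent D s) (tangent D t))"
proof -
  have "tangent D (frac r) = tangent D r" for r by (rule tangent_congr) (simp add: frac_def)
  then show ?thesis using over_under_time[OF assms] by (simp add: crossing_sign_def)
qed

lemma direction_avoids_arc:
  assumes "a < t0" "t0 < b" "\<And>t. t \<in> {a..b} \<Longrightarrow> curve D t = curve D t0 \<Longrightarrow> t = t0"
    and det: "det2 (tangent D t0) w \<noteq> 0"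
  shows "\<forall>\<^sub>F e in at_right 0. curve D t0 + e *\<^sub>R w \<notin> curve D ` {a..b}"
proof -
  have w: "norm w > 0" using det by (auto simp: det2_def)
  obtain \<epsilon> where \<epsilon>: "\<epsilon> > 0"
    "\<And>x. \<lbrakk>x \<noteq> 0; norm x < \<epsilon>; (\<bar>det2 (tangent D t0) w\<bar> / norm w) * norm x \<le> \<bar>det2 (tangent D t0) x\<bar>\<rbrakk>
       \<Longrightarrow> curve D t0 + x \<notin> curve D ` {a..b}"
    using cone_avoids_arc[OF continuous_curve refl assms(3) has_tangent tangent_nonzero,
        of a b "\<bar>det2 (tangent D t0) w\<bar> / norm w"] det w by auto
  show ?thesis unfolding eventually_at_right_field
  proof (intro exI[of _ "\<epsilon> / norm w"] conjI allI impI)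
    show "0 < \<epsilon> / norm w" using \<epsilon> w by simp
    fix e assume e: "0 < e" "e < \<epsilon> / norm w"
    show "curve D t0 + e *\<^sub>R w \<notin> curve D ` {a..b}"
      using e w by (intro \<epsilon>(2)) (auto simp: det2_scaleR_right abs_mult field_simps)
  qed
qed

lemma direction_avoids_curve:
  assumes dt: "double_times D s t"
    and det: "det2 (tangent D s) w \<noteq> 0" "det2 (tangent D t) w \<noteq> 0"
  shows "\<forall>\<^sub>F e in at_right 0. curve D s + e *\<^sub>R w \<notin> range (curve D)"
proof -
  \<comment> \<open>Represent the second time in the period after \<open>s\<close>, and cut the circle halfway between the two.\<close>
  define t' where "t' = s + frac (t - s)"
  have tt': "t' - t \<in> \<int>" by (simp add: t'_def frac_def)
  have st: "curve D s = curve D t" "t - s \<notin> \<int>"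
    using dt double_times_sym by (auto simp: double_times_def)
  have fr: "0 < frac (t - s)" "frac (t - s) < 1"
    using st(2) frac_lt_1 by (auto simp: frac_gt_0_iff)
  then have t': "s < t'" "t' < s + 1" by (auto simp: t'_def)
  have ct': "curve D t' = curve D s" "tangent D t' = tangent D t"
    using curve_congr[OF tt'] tangent_congr[OF tt'] st by auto
  define a where "a = (s + t' - 1) / 2"
  define m where "m = (s + t') / 2"
  have no_int: "x \<notin> \<int>" if "0 < x" "x < 1" for x :: real
    using that by (auto elim!: Ints_cases)
  have cases: "r - s \<in> \<int> \<or> r - t' \<in> \<int>" if "curve D r = curve D s" for r
  proof -
    have "s - t' \<notin> \<int>" using no_int[of "t' - s"] t' Ints_minus[of "s - t'"] by auto
    then show ?thesis using same_point_times[OF that ct'(1)[symmetric]] by blast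
  qed
  have eq0: "r = 0" if "r \<in> \<int>" "-1 < r" "r < 1" for r :: real
    using that no_int[of r] no_int[of "-r"] Ints_minus[of r] by (meson linorder_cases neg_0_less_iff_less minus_less_iff) 
  have 1: "\<forall>\<^sub>F e in at_right 0. curve D s + e *\<^sub>R w \<notin> curve D ` {a..m}"
  proof (rule direction_avoids_arc)
    fix r assume r: "r \<in> {a..m}" "curve D r = curve D s"
    then have "-1 < r - t'" "r - t' < 0" "-1 < r - s" "r - s < 1"
      using t' by (auto simp: a_def m_def field_simps)
    then show "r = s" using cases[OF r(2)] eq0[of "r - s"] eq0[of "r - t'"] by auto
  qed (use t' det in \<open>auto simp: a_def m_def field_simps\<close>)
  have 2: "\<forall>\<^sub>F e in at_right 0. curve D t' + e *\<^sub>R w \<notin> curve D ` {m..a + 1}"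
  proof (rule direction_avoids_arc)
    fix r assume r: "r \<in> {m..a + 1}" "curve D r = curve D t'"
    then have "0 < r - s" "r - s < 1" "-1 < r - t'" "r - t' < 1"
      using t' by (auto simp: a_def m_def field_simps)
    then show "r = t'" using cases[of r] r(2) ct' eq0[of "r - s"] eq0[of "r - t'"] by auto
  qed (use t' det ct' in \<open>auto simp: a_def m_def field_simps\<close>)
  have "range (curve D) = curve D ` {a..m} \<union> curve D ` {m..a + 1}"
    unfolding range_curve_period[of a] image_Un[symmetric]
    using t' by (subst ivl_disj_un_two_touch(4)) (auto simp: a_def m_def field_simps)
  then show ?thesis using eventually_conj[OF 1 2] ct'(1) by (auto elim: eventually_mono)
qed

text \<open>
  A short segment starting at \<open>c\<close> is connected and misses the curve, so it determines the adjacent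
  region, and the winding number is constant on that region.
\<close>

lemma region_index_eq:
  assumes av: "\<forall>\<^sub>F e in at_right 0. c + e *\<^sub>R w \<notin> range (curve D)"
  shows "\<forall>\<^sub>F e in at_right 0. region_index D
           (THE R. R \<in> regions D \<and> (\<forall>\<^sub>F e in at_right 0. c + e *\<^sub>R w \<in> R))
         = Re (winding_number (curve D) (c + e *\<^sub>R w))"
proof -
  obtain e0 where e0: "e0 > 0" "\<And>e. 0 < e \<Longrightarrow> e < e0 \<Longrightarrow> c + e *\<^sub>R w \<notin> range (curve D)"
    using av unfolding eventually_at_right_field by auto
  let ?I = "(\<lambda>e. c + e *\<^sub>R w) ` {0<..<e0}"
  have I2: "?I \<subseteq> - range (curve D)"
    by (rule image_subsetI) (metis ComplI e0(2) greaterThanLessThan_iff)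
  have I: "connected ?I"
    by (intro connected_continuous_image continuous_intros) auto
  define R where "R = connected_component_set (- range (curve D)) (c + (e0 / 2) *\<^sub>R w)"
  have mid: "c + (e0 / 2) *\<^sub>R w \<in> ?I" using e0 by (intro imageI) auto
  have IR: "?I \<subseteq> R" unfolding R_def by (rule connected_component_maximal[OF mid I I2])
  have R: "R \<in> regions D" using I2 mid unfolding R_def regions_def components_def by blast
  have ev: "\<forall>\<^sub>F e in at_right 0. c + e *\<^sub>R w \<in> R"
    unfolding eventually_at_right_field using e0(1) IR by (intro exI[of _ e0]) (auto simp: image_subset_iff)
  have "(THE R. R \<in> regions D \<and> (\<forall>\<^sub>F e in at_right 0. c + e *\<^sub>R w \<in> R)) = R"
  proof (rule the_equality)
    fix R' assume R': "R' \<in> regions D \<and> (\<forall>\<^sub>F e in at_right 0. c + e *\<^sub>R w \<in> R')"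
    then have "\<forall>\<^sub>F e in at_right 0. c + e *\<^sub>R w \<in> R \<inter> R'" using ev by (auto elim: eventually_elim2)
    then have "R \<inter> R' \<noteq> {}" using eventually_happens'[OF trivial_limit_at_right_real] by blast
    then show "R' = R" using R R' components_nonoverlap unfolding regions_def by blast
  qed (use R ev in auto)
  moreover have "region_index D R = Re (winding_number (curve D) z)" if "z \<in> R" for z
  proof -
    have "connected R" "R \<inter> range (curve D) = {}"
      using R in_components_connected in_components_subset unfolding regions_def by blast+
    then have "winding_number (curve D) constant_on R"
      using winding_number_constant[of "curve D" R] path_curve by auto
    moreover have "(SOME z. z \<in> R) \<in> R" using that by (rule someI)
    ultimately show ?thesis using that unfolding region_index_def constant_on_def by metis
  qed
  ultimately show ?thesis using ev by (auto elim: eventually_mono)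
qed

text \<open>
  The definition of the index distinguishes the upper from the lower branch only through the order of
  summation over the corners, so the two times of the crossing may be given in either order.
\<close>

lemma crossing_index_eventually:
  assumes dt: "double_times D s t"
  shows "\<forall>\<^sub>F e in at_right 0. crossing_index D (curve D s) =
     (\<Sum>x\<in>{1, -1}. \<Sum>y\<in>{1, -1}.
        Re (winding_number (curve D) (curve D s + e *\<^sub>R (x *\<^sub>R tangent D s + y *\<^sub>R tangent D t)))) / 4
     \<and> (\<forall>x\<in>{1, -1}. \<forall>y\<in>{1, -1}. curve D s + e *\<^sub>R (x *\<^sub>R tangent D s + y *\<^sub>R tangent D t) \<notin> range (curve D))"
proof -
  have main: "\<forall>\<^sub>F e in at_right 0. crossing_index D (curve D s) =
     (\<Sum>x\<in>{1, -1}. \<Sum>y\<in>{1, -1}.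
        Re (winding_number (curve D) (curve D s + e *\<^sub>R (x *\<^sub>R tangent D s + y *\<^sub>R tangent D t)))) / 4
     \<and> (\<forall>x\<in>{1, -1}. \<forall>y\<in>{1, -1}. curve D s + e *\<^sub>R (x *\<^sub>R tangent D s + y *\<^sub>R tangent D t) \<notin> range (curve D))"
    if dt: "double_times D s t" and over: "s \<in> overpass D" for s t
  proof -
    define dir where "dir = (\<lambda>x y. x *\<^sub>R tangent D s + y *\<^sub>R tangent D t)"
    have tf: "tangent D (frac r) = tangent D r" for r by (rule tangent_congr) (simp add: frac_def)
    have av: "\<forall>\<^sub>F e in at_right 0. curve D s + e *\<^sub>R dir x y \<notin> range (curve D)"
      if "x \<noteq> 0" "y \<noteq> 0" for x y :: real
      using that transverse[OF dt] det2_swap[of "tangent D s" "tangent D t"]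
      by (intro direction_avoids_curve[OF dt])
        (auto simp: dir_def det2_add_right det2_scaleR_right det2_self)
    have idx: "\<forall>\<^sub>F e in at_right 0. region_index D (corner_region D (curve D s) x y)
        = Re (winding_number (curve D) (curve D s + e *\<^sub>R dir x y))"
      if "x \<noteq> 0" "y \<noteq> 0" for x y :: real
      using region_index_eq[OF av[OF that]] over_under_time[OF dt over]
      by (simp add: corner_region_def tf dir_def)
    have "\<forall>\<^sub>F e in at_right 0. \<forall>x\<in>{1, -1}. \<forall>y\<in>{1, -1}.
        region_index D (corner_region D (curve D s) x y) = Re (winding_number (curve D) (curve D s + e *\<^sub>R dir x y))
        \<and> curve D s + e *\<^sub>R dir x y \<notin> range (curve D)"
      using av idx by (auto simp: eventually_conj_iff)
    then show ?thesis
      by eventually_elim (auto simp: crossing_index_def dir_def)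
  qed
  show ?thesis
  proof (cases "s \<in> overpass D")
    case True
    then show ?thesis using main dt by blast
  next
    case False
    then have "t \<in> overpass D" using dt overpass_iff by blast
    from main[OF _ this, of s] dt double_times_sym
    have *: "\<forall>\<^sub>F e in at_right 0. crossing_index D (curve D t) =
     (\<Sum>x\<in>{1, -1}. \<Sum>y\<in>{1, -1}.
        Re (winding_number (curve D) (curve D t + e *\<^sub>R (x *\<^sub>R tangent D t + y *\<^sub>R tangent D s)))) / 4
     \<and> (\<forall>x\<in>{1, -1}. \<forall>y\<in>{1, -1}. curve D t + e *\<^sub>R (x *\<^sub>R tangent D t + y *\<^sub>R tangent D s) \<notin> range (curve D))"
      by blast
    have eq: "curve D t = curve D s" using dt by (simp add: double_times_def)
    show ?thesis using *
      unfolding eq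
      by eventually_elim (auto simp: add.commute minus_diff_commute[of "tangent D t" "tangent D s"])
  qed
qed

end

section \<open>The strands of the move and their loops\<close>

text \<open>
  The times in the gaps between the strands at which the curve is divided into the three arcs; the last
  one is a period after the first one.
\<close>

definition cut :: "omega3_data \<Rightarrow> nat \<Rightarrow> real" where
  "cut M i = (if i = 0 then (leave M 2 - 1 + enter M 0) / 2
              else if i = 3 then (leave M 2 + enter M 0 + 1) / 2
              else (leave M (i - 1) + enter M i) / 2)"

lemma less_3_cases: "(i::nat) < 3 \<Longrightarrow> i = 0 \<or> i = 1 \<or> i = 2"
  by auto

lemma jumps_across_direction:
  assumes jump: "jumps_across V A p u n" and det: "det2 u w \<noteq> 0"
  shows "\<forall>\<^sub>F e in at_right 0. V (p + e *\<^sub>R w) = n + of_bool (det2 u w > 0)"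
proof -
  have "((\<lambda>e. p + e *\<^sub>R w) has_vector_derivative w) (at 0)"
    by (auto intro!: derivative_eq_intros)
  from jumps_across_curve(1)[OF jump this _ det] show ?thesis
    by (auto elim: eventually_mono)
qed

text \<open>
  What the diagrams before and after a move have in common: both are traversed by three strands with the
  same times of entry and exit.
\<close>

locale strand_diagram = diagram D for D +
  fixes M :: omega3_data
  assumes disc: "disc M homeomorphic cball (0 :: complex) 1"
    and times: "enter M 0 < leave M 0" "leave M 0 < enter M 1" "enter M 1 < leave M 1"
      "leave M 1 < enter M 2" "enter M 2 < leave M 2" "leave M 2 < enter M 0 + 1"
    and strands: "three_strands M D"
begin

abbreviation en where "en \<equiv> enter M"
abbreviation lv where "lv \<equiv> leave M"
abbreviation mt where "mt \<equiv> meet_time M D"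

lemma en_lv: "i < 3 \<Longrightarrow> en i < lv i"
  using times less_3_cases by blast

lemma lv_en: "i < j \<Longrightarrow> j < 3 \<Longrightarrow> lv i < en j"
  using times less_3_cases[of j] less_3_cases[of i] by auto

lemma closed_disc: "closed (disc M)"
  using disc homeomorphic_compactness compact_cball compact_imp_closed by blast

lemma frontier_subset_disc: "frontier (disc M) \<subseteq> disc M"
  using closed_disc frontier_subset_closed by blast

lemma strand_interior: "i < 3 \<Longrightarrow> t \<in> {en i<..<lv i} \<Longrightarrow> curve D t \<in> interior (disc M)"
  and enter_frontier: "i < 3 \<Longrightarrow> curve D (en i) \<in> frontier (disc M)"
  and leave_frontier: "i < 3 \<Longrightarrow> curve D (lv i) \<in> frontier (disc M)"
  and strand_inj: "i < 3 \<Longrightarrow> inj_on (curve D) {en i..lv i}"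
  and no_frontier_crossing: "crossings D \<inter> frontier (disc M) = {}"
  and meet_unique: "i < 3 \<Longrightarrow> j < 3 \<Longrightarrow> i \<noteq> j \<Longrightarrow>
     \<exists>!t. t \<in> strand M i \<and> (\<exists>s\<in>strand M j. curve D s = curve D t)"
  using strands unfolding three_strands_def strand_def by blast+

lemma strand_in_disc: "i < 3 \<Longrightarrow> t \<in> {en i..lv i} \<Longrightarrow> curve D t \<in> disc M"
  using strand_interior[of i t] enter_frontier[of i] leave_frontier[of i]
    frontier_subset_disc interior_subset[of "disc M"]
  by (cases "t = en i \<or> t = lv i") auto

lemma gap_outside:
  assumes "lv 0 < t \<and> t < en 1 \<or> lv 1 < t \<and> t < en 2 \<or> lv 2 < t \<and> t < en 0 + 1
    \<or> lv 2 < t + 1 \<and> t < en 0"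
  shows "curve D t \<notin> disc M"
proof -
  have main: "curve D t \<notin> disc M"
    if t: "lv 0 < t \<and> t < en 1 \<or> lv 1 < t \<and> t < en 2 \<or> lv 2 < t \<and> t < en 0 + 1" for t
  proof -
    have "en 0 \<le> t" "t < en 0 + 1" using t times by linarith+
    moreover have "t \<notin> {en 0..lv 0}" "t \<notin> {en 1..lv 1}" "t \<notin> {en 2..lv 2}"
      using t times unfolding atLeastAtMost_iff by linarith+
    then have "t \<notin> (\<Union>i<3. {en i..lv i})" using less_3_cases by blast
    ultimately show ?thesis using strands unfolding three_strands_def by simp
  qed
  show ?thesis
  proof (cases "lv 2 < t + 1 \<and> t < en 0")
    case True
    then have "curve D (t + 1) \<notin> disc M" by (intro main) linarith
    then show ?thesis using curve_period[of t 1] by simp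
  next
    case False
    then show ?thesis using assms by (intro main) blast
  qed
qed

lemma cut_props:
  assumes "i < 3"
  shows "cut M i < en i" "lv i < cut M (Suc i)"
    and "t \<in> {cut M i..<en i} \<Longrightarrow> curve D t \<notin> disc M"
    and "t \<in> {lv i<..cut M (Suc i)} \<Longrightarrow> curve D t \<notin> disc M"
proof -
  have c: "cut M 0 = (lv 2 - 1 + en 0) / 2" "cut M 1 = (lv 0 + en 1) / 2"
    "cut M 2 = (lv 1 + en 2) / 2" "cut M 3 = (lv 2 + en 0 + 1) / 2"
    by (simp_all add: cut_def)
  have s: "Suc 0 = 1" "Suc 1 = 2" "Suc 2 = 3" by simp_all
  note cs = less_3_cases[OF assms]
  show "cut M i < en i" "lv i < cut M (Suc i)"
    using cs times unfolding atomize_conj by (elim disjE) (simp_all only: s c, auto)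
  show "curve D t \<notin> disc M" if t: "t \<in> {cut M i..<en i}"
    using cs
  proof (elim disjE)
    assume i: "i = 0"
    then have "lv 2 < t + 1 \<and> t < en 0" using t times unfolding i c by (simp add: field_simps)
    then show ?thesis by (intro gap_outside) blast
  next
    assume i: "i = 1"
    then have "lv 0 < t \<and> t < en 1" using t times unfolding i c by (simp add: field_simps)
    then show ?thesis by (intro gap_outside) blast
  next
    assume i: "i = 2"
    then have "lv 1 < t \<and> t < en 2" using t times unfolding i c by (simp add: field_simps)
    then show ?thesis by (intro gap_outside) blast
  qed
  show "curve D t \<notin> disc M" if t: "t \<in> {lv i<..cut M (Suc i)}"
    using cs
  proof (elim disjE)
    assume i: "i = 0"
    then have "lv 0 < t \<and> t < en 1" using t times unfolding i s c by (simp add: field_simps)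
    then show ?thesis by (intro gap_outside) blast
  next
    assume i: "i = 1"
    then have "lv 1 < t \<and> t < en 2" using t times unfolding i s c by (simp add: field_simps)
    then show ?thesis by (intro gap_outside) blast
  next
    assume i: "i = 2"
    then have "lv 2 < t \<and> t < en 0 + 1" using t times unfolding i s c by (simp add: field_simps)
    then show ?thesis by (intro gap_outside) blast
  qed
qed

lemma cut_3: "cut M 3 = cut M 0 + 1"
  by (simp add: cut_def field_simps)

lemma cut_less: "i < 3 \<Longrightarrow> cut M i < cut M (Suc i)"
  using cut_props(1,2)[of i] en_lv[of i] by linarith

definition arc_image :: "nat \<Rightarrow> complex set" where
  "arc_image i = curve D ` {cut M i..cut M (Suc i)}"

lemma in_disc_time:
  assumes "i < 3" "t \<in> {cut M i..cut M (Suc i)}" "curve D t \<in> disc M"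
  shows "t \<in> {en i..lv i}"
  using cut_props(3,4)[OF assms(1), of t] assms by force

lemma disc_time_representative:
  assumes "curve D s \<in> disc M"
  obtains i s' where "i < 3" "s' \<in> {en i..lv i}" "s' - s \<in> \<int>"
proof -
  define s' where "s' = cut M 0 + frac (s - cut M 0)"
  have int: "s' - s \<in> \<int>" by (simp add: s'_def frac_def)
  then have d: "curve D s' \<in> disc M" using curve_congr assms by simp
  have "cut M 0 \<le> s'" "s' \<le> cut M 3"
    using frac_lt_1[of "s - cut M 0"] by (simp_all add: s'_def cut_3)
  then consider "s' \<in> {cut M 0..cut M (Suc 0)}" | "s' \<in> {cut M 1..cut M (Suc 1)}" | "s' \<in> {cut M 2..cut M (Suc 2)}"
    by (force simp: numeral_3_eq_3 numeral_2_eq_2)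
  then show thesis
    using in_disc_time[OF _ _ d, of 0] in_disc_time[OF _ _ d, of 1] in_disc_time[OF _ _ d, of 2]
      that[OF _ _ int, of 0] that[OF _ _ int, of 1] that[OF _ _ int, of 2] by cases auto
qed

lemma strand_times_differ:
  assumes "i < 3" "j < 3" "i \<noteq> j" "s \<in> {en i..lv i}" "t \<in> {en j..lv j}"
  shows "s - t \<notin> \<int>"
proof -
  have range: "en 0 \<le> r" "r < en 0 + 1" if "k < 3" "r \<in> {en k..lv k}" for k r
    using times that less_3_cases[OF that(1)] by auto
  have "s \<noteq> t"
    using lv_en[of i j] lv_en[of j i] assms by (cases i j rule: linorder_cases) auto
  moreover have "\<bar>s - t\<bar> < 1" using range[of i s] range[of j t] assms by auto
  ultimately show ?thesis by (auto elim!: Ints_cases simp flip: of_int_abs)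
qed

lemma meet:
  assumes "i < 3" "j < 3" "i \<noteq> j"
  shows "mt i j \<in> {en i<..<lv i}" "curve D (mt i j) = curve D (mt j i)"
    "double_times D (mt i j) (mt j i)"
proof -
  have P: "mt i j \<in> strand M i \<and> (\<exists>s\<in>strand M j. curve D s = curve D (mt i j))"
    if "i < 3" "j < 3" "i \<noteq> j" for i j
    unfolding meet_time_def by (rule theI'[OF meet_unique[OF that]])
  show 1: "mt i j \<in> {en i<..<lv i}" using P[OF assms] by (simp add: strand_def)
  obtain s where s: "s \<in> strand M j" "curve D s = curve D (mt i j)" using P[OF assms] by blast
  then have "s = mt j i"
    using meet_unique[of j i] assms P[of j i] P[OF assms] by metis
  then show 2: "curve D (mt i j) = curve D (mt j i)" using s by simp
  have "mt j i \<in> {en j<..<lv j}" using P[of j i] assms by (simp add: strand_def)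
  then show "double_times D (mt i j) (mt j i)"
    using strand_times_differ[OF assms, of "mt i j" "mt j i"] 1 2 by (auto simp: double_times_def)
qed

text \<open>
  The crossings avoid the boundary of the disc, so the end points of the strands, which the uniqueness
  of the meeting times leaves out, are no meeting points either.
\<close>

lemma meet_closed:
  assumes ij: "i < 3" "j < 3" "i \<noteq> j"
    and t: "t \<in> {en j..lv j}" and s: "s \<in> {en i..lv i}" and eq: "curve D t = curve D s"
  shows "t = mt j i"
proof -
  have "curve D t \<in> crossings D"
    using strand_times_differ[of j i t s] assms by (auto simp: crossings_def double_times_def)
  then have nf: "curve D t \<notin> frontier (disc M)" using no_frontier_crossing by blast
  then have "t \<in> strand M j" using enter_frontier[of j] leave_frontier[of j] t ij
    by (auto simp: strand_def order_le_less)
  moreover have "s \<in> strand M i" using enter_frontier[of i] leave_frontier[of i] s ij nf eq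
    by (auto simp: strand_def order_le_less)
  moreover have "mt j i \<in> strand M j" "mt i j \<in> strand M i" "curve D (mt i j) = curve D (mt j i)"
    using meet[of j i] meet[of i j] ij by (auto simp: strand_def)
  ultimately show ?thesis using meet_unique[of j i] ij eq by metis
qed

lemma strand_meets_arc:
  assumes "i < 3" "j < 3" "i \<noteq> j" "t \<in> {en j..lv j}" "curve D t \<in> arc_image i"
  shows "t = mt j i"
proof -
  obtain s where s: "s \<in> {cut M i..cut M (Suc i)}" "curve D t = curve D s"
    using assms by (auto simp: arc_image_def)
  then have "s \<in> {en i..lv i}" using in_disc_time[of i s] strand_in_disc[of j t] assms by simp
  then show ?thesis using meet_closed assms s by blast
qed

lemma meet_distinct:
  assumes "i < 3" "j < 3" "k < 3" "i \<noteq> j" "i \<noteq> k" "j \<noteq> k"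
  shows "curve D (mt i j) \<noteq> curve D (mt i k)"
proof
  assume eq: "curve D (mt i j) = curve D (mt i k)"
  have "mt i j - mt j i \<notin> \<int>" "mt j i - mt k i \<notin> \<int>" "mt i j - mt k i \<notin> \<int>"
    using meet(1)[of i j] meet(1)[of j i] meet(1)[of k i] assms strand_times_differ[of i j "mt i j" "mt j i"]
      strand_times_differ[of j k "mt j i" "mt k i"] strand_times_differ[of i k "mt i j" "mt k i"] by auto
  then show False
    using same_point_times[of "mt i j" "mt j i" "mt k i"] meet(2)[of i j] meet(2)[of i k] assms eq by simp
qed

lemma crossings_in_disc:
  "crossings D \<inter> disc M = {curve D (mt 0 1), curve D (mt 1 2), curve D (mt 2 0)}"
proof
  have "curve D (mt i j) \<in> crossings D \<inter> disc M" if "i < 3" "j < 3" "i \<noteq> j" for i j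
    using meet[OF that] strand_in_disc[of i "mt i j"] that by (auto simp: crossings_def)
  then show "{curve D (mt 0 1), curve D (mt 1 2), curve D (mt 2 0)} \<subseteq> crossings D \<inter> disc M" by simp
  show "crossings D \<inter> disc M \<subseteq> {curve D (mt 0 1), curve D (mt 1 2), curve D (mt 2 0)}"
  proof
    fix c assume c: "c \<in> crossings D \<inter> disc M"
    then obtain s t where st: "double_times D s t" "curve D s = c" by (auto simp: crossings_def)
    have ct: "curve D t = c" using st by (simp add: double_times_def)
    obtain i s' where i: "i < 3" "s' \<in> {en i..lv i}" "s' - s \<in> \<int>"
      using disc_time_representative[of s] c st by auto
    obtain j t' where j: "j < 3" "t' \<in> {en j..lv j}" "t' - t \<in> \<int>"
      using disc_time_representative[of t] c ct by auto
    have eq: "curve D s' = c" "curve D t' = c"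
      using curve_congr[OF i(3)] curve_congr[OF j(3)] st ct by auto
    have "i \<noteq> j"
    proof
      assume "i = j"
      then have "s' = t'" using strand_inj[of i] i j eq by (auto simp: inj_on_def)
      then have "s - t = (t' - t) - (s' - s)" by simp
      then have "s - t \<in> \<int>" by (simp only: Ints_diff i(3) j(3))
      then show False using st by (simp add: double_times_def)
    qed
    then have "c = curve D (mt i j)" "c = curve D (mt j i)"
      using meet_closed[of i j t' s'] meet_closed[of j i s' t'] i j eq by auto
    then show "c \<in> {curve D (mt 0 1), curve D (mt 1 2), curve D (mt 2 0)}"
      using less_3_cases[OF i(1)] less_3_cases[OF j(1)] \<open>i \<noteq> j\<close> by auto
  qed
qed

end

text \<open>
  The paths \<open>\<beta> i\<close> connect a base point with the cut points outside the disc. They are a parameter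
  because the diagrams before and after the move have to be closed up by the same paths.
\<close>

locale looped_strand_diagram = strand_diagram D M for D M +
  fixes \<beta> :: "nat \<Rightarrow> real \<Rightarrow> complex"
  assumes path_\<beta>: "\<And>i. path (\<beta> i)"
    and start_\<beta>: "\<And>i. pathstart (\<beta> i) = curve D (cut M 0)"
    and finish_\<beta>: "\<And>i. i \<le> 3 \<Longrightarrow> pathfinish (\<beta> i) = curve D (cut M i)"
    and outside_\<beta>: "\<And>i. path_image (\<beta> i) \<subseteq> - disc M"
    and \<beta>_3: "\<beta> 3 = \<beta> 0"
begin

text \<open>
  The winding number of the loop \<open>L\<^sub>i\<close>, which runs along \<open>\<beta> i\<close>, then along the arc of the curve that contains
  strand \<open>i\<close>, and back along \<open>\<beta> (Suc i)\<close>. Written as a sum, it makes the contributions of the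
  closing paths cancel visibly in the sum over the three loops.
\<close>

definition loop_winding :: "nat \<Rightarrow> complex \<Rightarrow> complex" where
  "loop_winding i z = winding_number (subpath (cut M i) (cut M (Suc i)) (curve D)) z
     + (winding_number (\<beta> i) z - winding_number (\<beta> (Suc i)) z)"

definition loop_image :: "nat \<Rightarrow> complex set" where
  "loop_image i = arc_image i \<union> path_image (\<beta> i) \<union> path_image (\<beta> (Suc i))"

lemma path_arc:
  "i < 3 \<Longrightarrow> path (subpath (cut M i) (cut M (Suc i)) (curve D))"
  "i < 3 \<Longrightarrow> path_image (subpath (cut M i) (cut M (Suc i)) (curve D)) = arc_image i"
  using path_subpath_of_continuous[OF continuous_curve] cut_less[of i]
  by (auto simp: path_image_subpath arc_image_def)

lemma loop_winding_integer:
  assumes "i < 3" "z \<notin> loop_image i"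
  shows "loop_winding i z \<in> \<int>"
proof -
  let ?\<sigma> = "subpath (cut M i) (cut M (Suc i)) (curve D)"
  let ?L = "(\<beta> i +++ ?\<sigma>) +++ reversepath (\<beta> (Suc i))"
  have ends: "pathfinish (\<beta> i) = pathstart ?\<sigma>" "pathfinish ?\<sigma> = pathstart (reversepath (\<beta> (Suc i)))"
    using finish_\<beta> assms by auto
  have z: "z \<notin> path_image (\<beta> i)" "z \<notin> path_image ?\<sigma>" "z \<notin> path_image (\<beta> (Suc i))"
    using assms path_arc by (auto simp: loop_image_def)
  have z2: "z \<notin> path_image (\<beta> i +++ ?\<sigma>)" using z ends by (simp add: path_image_join)
  have "winding_number ?L z = loop_winding i z"
    using z z2 ends path_arc[OF assms(1)] path_\<beta>
    by (simp add: loop_winding_def winding_number_join winding_number_reversepath)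
  moreover have "winding_number ?L z \<in> \<int>"
    using z z2 ends path_arc[OF assms(1)] path_\<beta> start_\<beta>
    by (intro integer_winding_number) (auto simp: path_image_join)
  ultimately show ?thesis by simp
qed

lemma closed_loop_image: "i < 3 \<Longrightarrow> closed (loop_image i)"
  unfolding loop_image_def
  using closed_path_image[OF path_arc(1)] path_arc(2)
  by (intro closed_Un closed_path_image path_\<beta>) metis

lemma continuous_loop_winding: "i < 3 \<Longrightarrow> continuous_on (- loop_image i) (loop_winding i)"
  unfolding loop_winding_def
  using path_arc path_\<beta>
  by (intro continuous_intros continuous_on_subset[OF continuous_on_winding_number])
     (auto simp: loop_image_def)

lemma loop_winding_constant:
  assumes "i < 3" "connected T" "T \<inter> loop_image i = {}" "x \<in> T" "y \<in> T"
  shows "loop_winding i x = loop_winding i y"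
  using assms integer_valued_constant[OF assms(2) continuous_on_subset[OF continuous_loop_winding[OF assms(1)]]]
    loop_winding_integer by blast

lemma disc_loop_image: "disc M \<inter> loop_image i = disc M \<inter> arc_image i"
  using outside_\<beta>[of i] outside_\<beta>[of "Suc i"] by (auto simp: loop_image_def)

lemma winding_number_sum_loops:
  assumes "z \<notin> range (curve D)"
  shows "winding_number (curve D) z = loop_winding 0 z + loop_winding 1 z + loop_winding 2 z"
proof -
  let ?W = "\<lambda>a b. winding_number (subpath a b (curve D)) z"
  have z: "z \<notin> curve D ` T" for T using assms by auto
  have c: "cut M 0 \<le> cut M 1" "cut M 1 \<le> cut M 2" "cut M 2 \<le> cut M 3"
    using cut_less[of 0] cut_less[of 1] cut_less[of 2] by (simp_all add: numeral_3_eq_3 numeral_2_eq_2)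
  have "winding_number (curve D) z = ?W (cut M 0) (cut M 3)"
    using winding_number_period[OF continuous_curve _ assms, of "cut M 0"] curve_period[of _ 1] cut_3 by simp
  also have "\<dots> = ?W (cut M 0) (cut M 1) + ?W (cut M 1) (cut M 3)"
    by (rule winding_number_subpath_add[OF continuous_curve _ _ z]) (use c in auto)
  also have "?W (cut M 1) (cut M 3) = ?W (cut M 1) (cut M 2) + ?W (cut M 2) (cut M 3)"
    by (rule winding_number_subpath_add[OF continuous_curve _ _ z]) (use c in auto)
  finally show ?thesis
    using \<beta>_3 by (simp add: loop_winding_def numeral_3_eq_3 numeral_2_eq_2)
qed

definition meet_det :: "nat \<Rightarrow> nat \<Rightarrow> real" where
  "meet_det i j = det2 (tangent D (mt i j)) (tangent D (mt j i))"

lemma meet_det_nonzero: "i < 3 \<Longrightarrow> j < 3 \<Longrightarrow> i \<noteq> j \<Longrightarrow> meet_det i j \<noteq> 0"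
  using transverse[OF meet(3)] by (simp add: meet_det_def)

lemma meet_det_swap: "meet_det j i = - meet_det i j"
  unfolding meet_det_def by (rule det2_swap)

lemma loop_winding_jumps:
  assumes ij: "i < 3" "j < 3" "i \<noteq> j"
  obtains n where "jumps_across (loop_winding i) (arc_image i) (curve D (mt i j)) (tangent D (mt i j)) n"
proof -
  let ?U = "- (path_image (\<beta> i) \<union> path_image (\<beta> (Suc i)))"
  have m: "mt i j \<in> {en i<..<lv i}" by (rule meet(1)[OF ij])
  have inU: "curve D (mt i j) \<in> ?U"
    using strand_in_disc[of i "mt i j"] m ij outside_\<beta>[of i] outside_\<beta>[of "Suc i"] by auto
  show thesis
  proof (rule winding_number_jumps_across_arc[of "cut M i" "cut M (Suc i)" "curve D" "mt i j"
        "curve D (mt i j)" "tangent D (mt i j)" ?U "\<lambda>z. winding_number (\<beta> i) z - winding_number (\<beta> (Suc i)) z"])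
    show "t = mt i j" if t: "t \<in> {cut M i..cut M (Suc i)}" "curve D t = curve D (mt i j)" for t
    proof -
      have "t \<in> {en i..lv i}" using t in_disc_time[of i t] strand_in_disc[of i "mt i j"] ij m by auto
      then show ?thesis using strand_inj[of i] ij m t by (auto simp: inj_on_def)
    qed
    show "open ?U" using closed_path_image[OF path_\<beta>] by (intro open_Compl closed_Un)
    show "continuous_on ?U (\<lambda>z. winding_number (\<beta> i) z - winding_number (\<beta> (Suc i)) z)"
      using path_\<beta> by (intro continuous_intros continuous_on_subset[OF continuous_on_winding_number]) auto
    show "winding_number (subpath (cut M i) (cut M (Suc i)) (curve D)) z +
         (winding_number (\<beta> i) z - winding_number (\<beta> (Suc i)) z) \<in> \<int>"
      if "z \<in> ?U" "z \<notin> curve D ` {cut M i..cut M (Suc i)}" for z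
      using loop_winding_integer[of i z] ij that by (auto simp: loop_winding_def loop_image_def arc_image_def)
    show "cut M i < mt i j" "mt i j < cut M (Suc i)" using m cut_props(1,2)[of i] ij by auto
  qed (use continuous_curve has_tangent tangent_nonzero inU that in \<open>auto simp: loop_winding_def[abs_def] arc_image_def\<close>)
qed

text \<open>
  The value of \<open>W\<^sub>i\<close> to the right of strand \<open>i\<close> at its crossing with strand \<open>j\<close>.
\<close>

definition lower :: "nat \<Rightarrow> nat \<Rightarrow> complex" where
  "lower i j = (SOME n. jumps_across (loop_winding i) (arc_image i) (curve D (mt i j)) (tangent D (mt i j)) n)"

lemma lower_jumps:
  "i < 3 \<Longrightarrow> j < 3 \<Longrightarrow> i \<noteq> j \<Longrightarrow>
   jumps_across (loop_winding i) (arc_image i) (curve D (mt i j)) (tangent D (mt i j)) (lower i j)"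
  unfolding lower_def using loop_winding_jumps someI by metis

text \<open>
  Strand \<open>j\<close> meets the loop \<open>L\<^sub>i\<close> in a single point, because the loop runs through the disc only along
  strand \<open>i\<close>.
\<close>

lemma loop_winding_along_strand:
  assumes ij: "i < 3" "j < 3" "i \<noteq> j"
  shows "t \<in> {en j..<mt j i} \<Longrightarrow> loop_winding i (curve D t) = lower i j + of_bool (meet_det i j < 0)"
    and "t \<in> {mt j i<..lv j} \<Longrightarrow> loop_winding i (curve D t) = lower i j + of_bool (meet_det i j > 0)"
proof -
  note m = meet(1)[OF ij(2,1) ij(3)[symmetric]]
  have off: "curve D ` T \<inter> loop_image i = {}" if "T \<subseteq> {en j..lv j} - {mt j i}" for T
    using strand_meets_arc[OF ij] strand_in_disc[OF ij(2)] disc_loop_image[of i] that by blast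
  have const: "loop_winding i (curve D s) = loop_winding i (curve D t)"
    if "connected T" "T \<subseteq> {en j..lv j} - {mt j i}" "s \<in> T" "t \<in> T" for s t T
    using that ij off[OF that(2)]
    by (intro loop_winding_constant[of i "curve D ` T"]) (auto intro: connected_continuous_image continuous_curve)
  have ev: "\<forall>\<^sub>F t in at_right (mt j i). curve D t \<notin> arc_image i \<and> loop_winding i (curve D t) = lower i j + of_bool (meet_det i j > 0)"
    "\<forall>\<^sub>F t in at_left (mt j i). curve D t \<notin> arc_image i \<and> loop_winding i (curve D t) = lower i j + of_bool (meet_det i j < 0)"
    unfolding meet_det_def
    using jumps_across_curve[OF lower_jumps[OF ij] has_tangent meet(2)[OF ij, symmetric]]
      meet_det_nonzero[OF ij] by (auto simp: meet_det_def)
  show "loop_winding i (curve D t) = lower i j + of_bool (meet_det i j < 0)" if t: "t \<in> {en j..<mt j i}"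
  proof -
    have "\<forall>\<^sub>F t in at_left (mt j i). t \<in> {en j..<mt j i} \<and> loop_winding i (curve D t) = lower i j + of_bool (meet_det i j < 0)"
      using ev(2) eventually_at_left_real[of "en j" "mt j i"] m by (auto elim: eventually_elim2)
    then obtain s where "s \<in> {en j..<mt j i}" "loop_winding i (curve D s) = lower i j + of_bool (meet_det i j < 0)"
      using eventually_happens'[OF trivial_limit_at_left_real] by blast
    moreover have "{en j..<mt j i} \<subseteq> {en j..lv j} - {mt j i}" using m by auto
    ultimately show ?thesis using const[of "{en j..<mt j i}" t s] t by auto
  qed
  show "loop_winding i (curve D t) = lower i j + of_bool (meet_det i j > 0)" if t: "t \<in> {mt j i<..lv j}"
  proof -
    have "\<forall>\<^sub>F t in at_right (mt j i). t \<in> {mt j i<..lv j} \<and> loop_winding i (curve D t) = lower i j + of_bool (meet_det i j > 0)"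
      using ev(1) eventually_at_right_real[of "mt j i" "lv j"] m by (auto elim: eventually_elim2)
    then obtain s where "s \<in> {mt j i<..lv j}" "loop_winding i (curve D s) = lower i j + of_bool (meet_det i j > 0)"
      using eventually_happens'[OF trivial_limit_at_right_real] by blast
    moreover have "{mt j i<..lv j} \<subseteq> {en j..lv j} - {mt j i}" using m by auto
    ultimately show ?thesis using const[of "{mt j i<..lv j}" t s] t by auto
  qed
qed

text \<open>
  The boundary values, at the ends of strand \<open>j\<close>, of the winding number of \<open>L\<^sub>i\<close>. Everything about the
  crossings in the disc that the move preserves is expressed through them.
\<close>

definition enter_index :: "nat \<Rightarrow> nat \<Rightarrow> real" where
  "enter_index i j = Re (loop_winding i (curve D (en j)))"

definition leave_index :: "nat \<Rightarrow> nat \<Rightarrow> real" where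
  "leave_index i j = Re (loop_winding i (curve D (lv j)))"

lemma boundary_indices:
  assumes ij: "i < 3" "j < 3" "i \<noteq> j"
  shows "enter_index i j = Re (lower i j) + of_bool (meet_det i j < 0)"
    and "leave_index i j = Re (lower i j) + of_bool (meet_det i j > 0)"
    and "sgn (meet_det i j) = leave_index i j - enter_index i j"
proof -
  note m = meet(1)[OF ij(2,1) ij(3)[symmetric]]
  show 1: "enter_index i j = Re (lower i j) + of_bool (meet_det i j < 0)"
    unfolding enter_index_def using m by (subst loop_winding_along_strand(1)[OF ij]) auto
  show 2: "leave_index i j = Re (lower i j) + of_bool (meet_det i j > 0)"
    unfolding leave_index_def using m by (subst loop_winding_along_strand(2)[OF ij]) auto
  show "sgn (meet_det i j) = leave_index i j - enter_index i j"
    unfolding 1 2 using meet_det_nonzero[OF ij] by (auto simp: sgn_if)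
qed

lemma third_loop_at_crossing:
  assumes ijk: "i < 3" "j < 3" "k < 3" "i \<noteq> j" "i \<noteq> k" "j \<noteq> k"
  shows "Re (loop_winding k (curve D (mt i j))) =
    (if mt i j < mt i k then enter_index k i else leave_index k i)"
proof -
  have ne: "mt i j \<noteq> mt i k" using meet_distinct[OF ijk] by metis
  have m: "mt i j \<in> {en i<..<lv i}" by (rule meet(1)) (use ijk in auto)
  have ki: "k < 3" "i < 3" "k \<noteq> i" using ijk by auto
  show ?thesis
    using loop_winding_along_strand[OF ki, of "mt i j"] boundary_indices[OF ki] m ne by auto
qed

text \<open>
  At the corner in direction \<open>x u + y v\<close> the side of strand \<open>i\<close> depends only on \<open>y\<close> and the side of
  strand \<open>j\<close> only on \<open>x\<close>. So two corners lie on either side of each strand, and the corner averages are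
  the means of the values on the two sides.
\<close>

lemma crossing_index_at_meet:
  assumes ijk: "i < 3" "j < 3" "k < 3" "i \<noteq> j" "i \<noteq> k" "j \<noteq> k"
  shows "crossing_index D (curve D (mt i j)) =
    (enter_index i j + leave_index i j + enter_index j i + leave_index j i) / 2
    + (if mt i j < mt i k then enter_index k i else leave_index k i)"
proof -
  define c where "c = curve D (mt i j)"
  define u where "u = tangent D (mt i j)"
  define v where "v = tangent D (mt j i)"
  have d: "det2 u v = meet_det i j" "det2 v u = meet_det j i" by (simp_all add: u_def v_def meet_det_def)
  have ij: "i < 3" "j < 3" "i \<noteq> j" and ji: "j < 3" "i < 3" "j \<noteq> i" using ijk by auto
  have nz: "meet_det i j \<noteq> 0" "meet_det j i \<noteq> 0" using meet_det_nonzero ij ji by blast+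
  have cji: "curve D (mt j i) = c" using meet(2)[OF ij] by (simp add: c_def)
  have dir_i: "\<forall>\<^sub>F e in at_right 0. loop_winding i (c + e *\<^sub>R (x *\<^sub>R u + y *\<^sub>R v)) = lower i j + of_bool (y * meet_det i j > 0)"
    if "y \<noteq> 0" for x y
    using jumps_across_direction[OF lower_jumps[OF ij], of "x *\<^sub>R u + y *\<^sub>R v"] nz that
    by (simp add: det2_add_right det2_scaleR_right det2_self d flip: u_def c_def)
  have dir_j: "\<forall>\<^sub>F e in at_right 0. loop_winding j (c + e *\<^sub>R (x *\<^sub>R u + y *\<^sub>R v)) = lower j i + of_bool (x * meet_det j i > 0)"
    if "x \<noteq> 0" for x y
    using jumps_across_direction[OF lower_jumps[OF ji], of "x *\<^sub>R u + y *\<^sub>R v"] nz that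
    by (simp add: det2_add_right det2_scaleR_right det2_self d cji flip: v_def)
  have cd: "c \<in> disc M" unfolding c_def using meet(1)[OF ij] strand_in_disc[of i "mt i j"] ij by auto
  have "c \<notin> arc_image k"
  proof
    assume "c \<in> arc_image k"
    then have "mt i j = mt i k"
      using strand_meets_arc[of k i "mt i j"] meet(1)[OF ij] ijk by (auto simp: c_def)
    then show False using meet_distinct[OF ijk] by simp
  qed
  then have "c \<in> - loop_image k" using cd disc_loop_image[of k] by blast
  then obtain r where r: "r > 0" "ball c r \<subseteq> - loop_image k"
    using closed_loop_image[OF ijk(3)] by (meson open_Compl openE)
  have near: "\<forall>\<^sub>F e in at_right 0. norm (e *\<^sub>R w) < r" for w :: complex
  proof -
    have "((\<lambda>e. norm (e *\<^sub>R w)) \<longlongrightarrow> norm (0 *\<^sub>R w)) (at_right 0)" by (intro tendsto_intros)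
    then show ?thesis using r(1) by (auto elim!: order_tendstoD)
  qed
  have dir_k: "\<forall>\<^sub>F e in at_right 0. loop_winding k (c + e *\<^sub>R w) = loop_winding k c" for w
    using near[of w]
  proof eventually_elim
    case (elim e)
    show ?case
      by (rule loop_winding_constant[OF ijk(3) connected_ball[of c r]]) (use r elim in \<open>auto simp: dist_norm\<close>)
  qed
  have sum3: "loop_winding 0 z + loop_winding 1 z + loop_winding 2 z
      = loop_winding i z + loop_winding j z + loop_winding k z" for z
    using less_3_cases[OF ijk(1)] less_3_cases[OF ijk(2)] less_3_cases[OF ijk(3)] ijk(4-6) by auto
  have "\<forall>\<^sub>F e in at_right 0. \<forall>x\<in>{1, -1}. \<forall>y\<in>{1, -1}.
      loop_winding i (c + e *\<^sub>R (x *\<^sub>R u + y *\<^sub>R v)) = lower i j + of_bool (y * meet_det i j > 0) \<and>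
      loop_winding j (c + e *\<^sub>R (x *\<^sub>R u + y *\<^sub>R v)) = lower j i + of_bool (x * meet_det j i > 0) \<and>
      loop_winding k (c + e *\<^sub>R (x *\<^sub>R u + y *\<^sub>R v)) = loop_winding k c"
  proof (intro eventually_ball_finite ballI eventually_conj)
    fix x y :: real assume "x \<in> {1, -1}" "y \<in> {1, -1}"
    then have "x \<noteq> 0" "y \<noteq> 0" by auto
    show "\<forall>\<^sub>F e in at_right 0. loop_winding i (c + e *\<^sub>R (x *\<^sub>R u + y *\<^sub>R v)) = lower i j + of_bool (y * meet_det i j > 0)"
      by (rule dir_i[OF \<open>y \<noteq> 0\<close>])
    show "\<forall>\<^sub>F e in at_right 0. loop_winding j (c + e *\<^sub>R (x *\<^sub>R u + y *\<^sub>R v)) = lower j i + of_bool (x * meet_det j i > 0)"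
      by (rule dir_j[OF \<open>x \<noteq> 0\<close>])
    show "\<forall>\<^sub>F e in at_right 0. loop_winding k (c + e *\<^sub>R (x *\<^sub>R u + y *\<^sub>R v)) = loop_winding k c"
      by (rule dir_k)
  qed auto
  with crossing_index_eventually[OF meet(3)[OF ij]]
  have "\<forall>\<^sub>F e in at_right (0::real). crossing_index D c =
      (\<Sum>x\<in>{1, -1}. \<Sum>y\<in>{1, -1}. Re (lower i j) + of_bool (y * meet_det i j > 0)
         + (Re (lower j i) + of_bool (x * meet_det j i > 0)) + Re (loop_winding k c)) / 4"
  proof eventually_elim
    case (elim e)
    have corner: "Re (winding_number (curve D) (c + e *\<^sub>R (x *\<^sub>R u + y *\<^sub>R v))) =
        Re (lower i j) + of_bool (y * meet_det i j > 0)
         + (Re (lower j i) + of_bool (x * meet_det j i > 0)) + Re (loop_winding k c)"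
      if "x \<in> {1, -1}" "y \<in> {1, -1}" for x y
    proof -
      have "c + e *\<^sub>R (x *\<^sub>R u + y *\<^sub>R v) \<notin> range (curve D)"
        using elim that unfolding c_def u_def v_def by blast
      note total = winding_number_sum_loops[OF this, unfolded sum3]
      have "loop_winding i (c + e *\<^sub>R (x *\<^sub>R u + y *\<^sub>R v)) = lower i j + of_bool (y * meet_det i j > 0)"
        "loop_winding j (c + e *\<^sub>R (x *\<^sub>R u + y *\<^sub>R v)) = lower j i + of_bool (x * meet_det j i > 0)"
        "loop_winding k (c + e *\<^sub>R (x *\<^sub>R u + y *\<^sub>R v)) = loop_winding k c"
        using elim that by blast+
      then show ?thesis unfolding total by (simp add: of_bool_def)
    qed
    have "crossing_index D c = (\<Sum>x\<in>{1, -1}. \<Sum>y\<in>{1, -1}.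
        Re (winding_number (curve D) (c + e *\<^sub>R (x *\<^sub>R u + y *\<^sub>R v)))) / 4"
      using elim unfolding c_def u_def v_def by blast
    also have "\<dots> = (\<Sum>x\<in>{1, -1}. \<Sum>y\<in>{1, -1}. Re (lower i j) + of_bool (y * meet_det i j > 0)
         + (Re (lower j i) + of_bool (x * meet_det j i > 0)) + Re (loop_winding k c)) / 4"
      by (intro arg_cong[where f = "\<lambda>r. r / 4"] sum.cong refl corner)
    finally show ?case .
  qed
  then have "crossing_index D c =
      (\<Sum>x\<in>{1, -1}. \<Sum>y\<in>{1, -1}. Re (lower i j) + of_bool (y * meet_det i j > 0)
         + (Re (lower j i) + of_bool (x * meet_det j i > 0)) + Re (loop_winding k c)) / 4"
    by (simp only: eventually_const trivial_limit_at_right_real simp_thms)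
  also have "\<dots> = (Re (lower i j) + 1 / 2) + (Re (lower j i) + 1 / 2) + Re (loop_winding k c)"
    using nz by (auto simp: field_simps)
  also have "\<dots> = (enter_index i j + leave_index i j + enter_index j i + leave_index j i) / 2 + Re (loop_winding k c)"
    using nz by (auto simp: boundary_indices(1,2)[OF ij] boundary_indices(1,2)[OF ji] field_simps)
  finally show ?thesis using third_loop_at_crossing[OF ijk] by (simp add: c_def)
qed

end

section \<open>Comparing the diagrams before and after the move\<close>

lemma winding_number_arcs_in_disc:
  fixes g h :: "real \<Rightarrow> complex"
  assumes S: "S homeomorphic cball (0 :: complex) 1"
    and cont: "continuous_on {a..b} g" "continuous_on {a..b} h" and ab: "a \<le> b"
    and ends: "g a = h a" "g b = h b"
    and sub: "g ` {a..b} \<subseteq> S" "h ` {a..b} \<subseteq> S" and z: "z \<notin> S"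
  shows "winding_number (subpath a b g) z = winding_number (subpath a b h) z"
proof -
  have "simply_connected S"
    using S convex_imp_simply_connected[OF convex_cball] homeomorphic_simply_connected_eq by blast
  then have "homotopic_paths S (subpath a b g) (subpath a b h)"
    using path_subpath_of_continuous[OF cont(1) ab] path_subpath_of_continuous[OF cont(2) ab] ends sub ab
    by (auto simp: simply_connected_eq_homotopic_paths path_image_subpath)
  then have "homotopic_paths (- {z}) (subpath a b g) (subpath a b h)"
    by (rule homotopic_paths_subset) (use z in auto)
  then show ?thesis by (rule winding_number_homotopic_paths)
qed

context looped_strand_diagram
begin

lemma SCI_split:
  "SCI D = (\<Sum>c\<in>crossings D - disc M. crossing_sign D c * crossing_index D c)
     + (\<Sum>(i, j)\<in>{(0, 1), (1, 2), (2, 0)}.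
          crossing_sign D (curve D (mt i j)) * crossing_index D (curve D (mt i j)))"
proof -
  have "curve D (mt 0 1) \<noteq> curve D (mt 1 2)" "curve D (mt 1 2) \<noteq> curve D (mt 2 0)"
    "curve D (mt 0 1) \<noteq> curve D (mt 2 0)"
    using meet_distinct[of 1 0 2] meet_distinct[of 2 1 0] meet_distinct[of 0 1 2]
      meet(2)[of 0 1] meet(2)[of 1 2] meet(2)[of 2 0] by auto
  then have "(\<Sum>c\<in>crossings D \<inter> disc M. crossing_sign D c * crossing_index D c)
     = (\<Sum>(i, j)\<in>{(0, 1), (1, 2), (2, 0)}.
          crossing_sign D (curve D (mt i j)) * crossing_index D (curve D (mt i j)))"
    unfolding crossings_in_disc by simp
  then show ?thesis
    unfolding SCI_def using sum.Int_Diff[OF finite_crossings, of "\<lambda>c. crossing_sign D c * crossing_index D c" "disc M"]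
    by linarith
qed

lemma strand_over_iff: "i < 3 \<Longrightarrow> j < 3 \<Longrightarrow> i \<noteq> j \<Longrightarrow> strand_over M D i j \<longleftrightarrow> \<not> strand_over M D j i"
  unfolding strand_over_def using overpass_iff[OF meet(3)] by blast

lemma crossing_sign_at_meet:
  assumes ij: "i < 3" "j < 3" "i \<noteq> j"
  shows "crossing_sign D (curve D (mt i j))
    = (if strand_over M D i j then 1 else -1) * (leave_index i j - enter_index i j)"
proof (cases "strand_over M D i j")
  case True
  then show ?thesis
    using crossing_sign_eq[OF meet(3)[OF ij]] boundary_indices(3)[OF ij]
    by (simp add: strand_over_def meet_det_def)
next
  case False
  have ji: "j < 3" "i < 3" "j \<noteq> i" using ij by auto
  have "mt j i \<in> overpass D" using False strand_over_iff[OF ij] by (simp add: strand_over_def)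
  from crossing_sign_eq[OF meet(3)[OF ji] this]
  have "crossing_sign D (curve D (mt i j)) = sgn (meet_det j i)"
    using meet(2)[OF ij] by (simp add: meet_det_def)
  also have "\<dots> = - sgn (meet_det i j)" using meet_det_swap[of j i] by (simp add: sgn_minus)
  finally show ?thesis using False boundary_indices(3)[OF ij] by simp
qed

end

text \<open>
  The relation between the two diagrams is symmetric, so that inclusions proved for the pair in one
  order can be used in the other order.
\<close>

locale strand_pair = b: looped_strand_diagram D M \<beta> + a: looped_strand_diagram D' M \<beta> for D D' M \<beta> +
  assumes same_outside: "\<And>t. curve D t \<notin> interior (disc M) \<or> curve D' t \<notin> interior (disc M) \<Longrightarrow>
      curve D' t = curve D t \<and> (t \<in> overpass D' \<longleftrightarrow> t \<in> overpass D)"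
begin

lemma same_boundary:
  assumes "i < 3"
  shows "curve D' (enter M i) = curve D (enter M i)" "curve D' (leave M i) = curve D (leave M i)"
  using b.enter_frontier[OF assms] b.leave_frontier[OF assms] same_outside by (auto simp: frontier_def)

lemma same_off_disc: "curve D t \<notin> disc M \<or> curve D' t \<notin> disc M \<Longrightarrow> curve D' t = curve D t"
  using same_outside interior_subset by blast

lemma same_arc_image_off_disc: "z \<notin> disc M \<Longrightarrow> z \<in> b.arc_image i \<longleftrightarrow> z \<in> a.arc_image i"
  unfolding b.arc_image_def a.arc_image_def using same_off_disc by (metis (no_types, lifting) image_iff)

text \<open>
  The arcs of the two diagrams coincide before the entry and after the exit of the strand, and between
  these times they are homotopic in the disc.
\<close>

lemma same_loop_winding_off_disc:
  assumes i: "i < 3" and z: "z \<notin> disc M" "z \<notin> b.arc_image i"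
  shows "a.loop_winding i z = b.loop_winding i z"
proof -
  have split: "winding_number (subpath (cut M i) (cut M (Suc i)) g) z
      = winding_number (subpath (cut M i) (enter M i) g) z
        + winding_number (subpath (enter M i) (leave M i) g) z
        + winding_number (subpath (leave M i) (cut M (Suc i)) g) z"
    if "continuous_on UNIV g" "z \<notin> g ` {cut M i..cut M (Suc i)}" for g
  proof -
    have c: "continuous_on T g" for T using that(1) continuous_on_subset by blast
    have "z \<notin> g ` {cut M i..leave M i}" using that(2) b.cut_props(2)[OF i] by auto
    then show ?thesis
      using winding_number_subpath_add[OF c, of "cut M i" "leave M i" "cut M (Suc i)" z]
        winding_number_subpath_add[OF c, of "cut M i" "enter M i" "leave M i" z]
        b.cut_props(1,2)[OF i] b.en_lv[OF i] that(2) by simp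
  qed
  have cong: "winding_number (subpath a b (curve D')) z = winding_number (subpath a b (curve D)) z"
    if "a \<le> b" "\<And>t. t \<in> {a..b} \<Longrightarrow> curve D' t = curve D t" for a b
  proof (rule winding_number_cong)
    fix t :: real assume t: "0 \<le> t" "t \<le> 1"
    have "0 \<le> (b - a) * t" using that t by simp
    moreover have "(b - a) * t \<le> (b - a) * 1" using that t by (intro mult_left_mono) auto
    ultimately show "subpath a b (curve D') t = subpath a b (curve D) t"
      unfolding subpath_def by (intro that) auto
  qed
  have 1: "winding_number (subpath (cut M i) (enter M i) (curve D')) z = winding_number (subpath (cut M i) (enter M i) (curve D)) z"
  proof (rule cong)
    fix t assume "t \<in> {cut M i..enter M i}"
    then show "curve D' t = curve D t"
      using b.cut_props(3)[OF i, of t] same_off_disc[of t] same_boundary[OF i] by (cases "t = enter M i") auto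
  qed (use b.cut_props(1)[OF i] in simp)
  have 2: "winding_number (subpath (leave M i) (cut M (Suc i)) (curve D')) z = winding_number (subpath (leave M i) (cut M (Suc i)) (curve D)) z"
  proof (rule cong)
    fix t assume "t \<in> {leave M i..cut M (Suc i)}"
    then show "curve D' t = curve D t"
      using b.cut_props(4)[OF i, of t] same_off_disc[of t] same_boundary[OF i] by (cases "t = leave M i") auto
  qed (use b.cut_props(2)[OF i] in simp)
  have 3: "winding_number (subpath (enter M i) (leave M i) (curve D')) z = winding_number (subpath (enter M i) (leave M i) (curve D)) z"
    using b.en_lv[OF i] same_boundary[OF i] b.strand_in_disc[OF i] a.strand_in_disc[OF i] z(1)
    by (intro winding_number_arcs_in_disc[OF b.disc] b.continuous_curve a.continuous_curve) auto
  have z': "z \<notin> a.arc_image i" using same_arc_image_off_disc z by blast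
  show ?thesis
    unfolding a.loop_winding_def b.loop_winding_def
    using split[OF b.continuous_curve] split[OF a.continuous_curve] 1 2 3 z(2) z'
    by (simp add: b.arc_image_def a.arc_image_def)
qed

text \<open>
  A boundary point of the disc that lies on neither loop is a limit of points outside the disc, where
  the two winding numbers agree; both are constant near the point.
\<close>

lemma same_loop_winding_frontier:
  assumes i: "i < 3" and p: "p \<in> frontier (disc M)" "p \<notin> b.arc_image i" "p \<notin> a.arc_image i"
  shows "a.loop_winding i p = b.loop_winding i p"
proof -
  have "p \<in> disc M" using p b.frontier_subset_disc by blast
  then have "p \<in> - (b.loop_image i \<union> a.loop_image i)"
    using p(2,3) b.disc_loop_image[of i] a.disc_loop_image[of i] by blast
  moreover have "open (- (b.loop_image i \<union> a.loop_image i))"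
    using b.closed_loop_image[OF i] a.closed_loop_image[OF i] by (intro open_Compl closed_Un)
  ultimately obtain r where r: "r > 0" "ball p r \<subseteq> - (b.loop_image i \<union> a.loop_image i)"
    by (meson openE)
  obtain z where z: "z \<in> ball p r" "z \<notin> disc M"
    using p(1) r(1) unfolding frontier_straddle by (auto simp: dist_commute)
  have "b.loop_winding i p = b.loop_winding i z"
    using r z by (intro b.loop_winding_constant[OF i connected_ball[of p r]]) auto
  moreover have "a.loop_winding i p = a.loop_winding i z"
    using r z by (intro a.loop_winding_constant[OF i connected_ball[of p r]]) auto
  moreover have "z \<notin> b.arc_image i" using r z by (auto simp: b.loop_image_def)
  ultimately show ?thesis using same_loop_winding_off_disc[OF i z(2)] by simp
qed

lemma same_boundary_indices:
  assumes ij: "i < 3" "j < 3" "i \<noteq> j"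
  shows "a.enter_index i j = b.enter_index i j" "a.leave_index i j = b.leave_index i j"
proof -
  have off: "curve D (enter M j) \<notin> b.arc_image i" "curve D (leave M j) \<notin> b.arc_image i"
    using b.strand_meets_arc[OF ij, of "enter M j"] b.strand_meets_arc[OF ij, of "leave M j"]
      b.meet(1)[of j i] b.en_lv[of j] ij by auto
  have off': "curve D' (enter M j) \<notin> a.arc_image i" "curve D' (leave M j) \<notin> a.arc_image i"
    using a.strand_meets_arc[OF ij, of "enter M j"] a.strand_meets_arc[OF ij, of "leave M j"]
      a.meet(1)[of j i] b.en_lv[of j] ij by auto
  show "a.enter_index i j = b.enter_index i j"
    unfolding a.enter_index_def b.enter_index_def
    using same_loop_winding_frontier[OF ij(1) b.enter_frontier[OF ij(2)]] off off' same_boundary[OF ij(2)] by simp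
  show "a.leave_index i j = b.leave_index i j"
    unfolding a.leave_index_def b.leave_index_def
    using same_loop_winding_frontier[OF ij(1) b.leave_frontier[OF ij(2)]] off off' same_boundary[OF ij(2)] by simp
qed

lemma same_winding_off_disc:
  assumes "z \<notin> disc M" "z \<notin> range (curve D)"
  shows "winding_number (curve D') z = winding_number (curve D) z"
proof -
  have "z \<notin> range (curve D')" using assms same_off_disc by auto
  moreover have "z \<notin> b.arc_image i" for i using assms by (auto simp: b.arc_image_def)
  ultimately show ?thesis
    using assms by (simp add: a.winding_number_sum_loops b.winding_number_sum_loops same_loop_winding_off_disc)
qed

lemma same_tangent_off_disc:
  assumes "curve D t \<notin> disc M"
  shows "tangent D' t = tangent D t"
proof (rule a.tangent_eqI)
  let ?T = "curve D -` (- disc M)"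
  have "open ?T" using b.closed_disc b.continuous_curve[of UNIV]
    by (intro open_vimage) (auto simp: open_Compl continuous_on_eq_continuous_at)
  then show "(curve D' has_vector_derivative tangent D t) (at t)"
    by (rule has_vector_derivative_transform_within_open[OF b.has_tangent])
      (use assms same_off_disc[symmetric] in auto)
qed

lemma double_times_off_disc:
  assumes "double_times D s t" "curve D s \<notin> disc M"
  shows "double_times D' s t" "curve D' s = curve D s" "curve D t \<notin> disc M"
  using assms same_off_disc[of s] same_off_disc[of t] by (auto simp: double_times_def)

lemma crossings_off_disc: "crossings D - disc M \<subseteq> crossings D' - disc M"
proof
  fix c assume "c \<in> crossings D - disc M"
  then obtain s t where "double_times D s t" "curve D s = c" "c \<notin> disc M" by (auto simp: crossings_def)
  then show "c \<in> crossings D' - disc M" using double_times_off_disc[of s t] by (auto simp: crossings_def)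
qed

lemma same_contribution_off_disc:
  assumes "c \<in> crossings D" "c \<notin> disc M"
  shows "crossing_sign D' c = crossing_sign D c" "crossing_index D' c = crossing_index D c"
proof -
  obtain s t where st: "double_times D s t" "curve D s = c" "s \<in> overpass D"
  proof -
    obtain s t where dt: "double_times D s t" and s: "curve D s = c"
      using assms by (auto simp: crossings_def)
    then have t: "curve D t = c" by (simp add: double_times_def)
    show thesis
      using that[OF dt s] that[OF _ t] b.overpass_iff[OF dt] b.double_times_sym[of s t] dt by blast
  qed
  note off = double_times_off_disc[OF st(1)]
  have out: "curve D s \<notin> disc M" using st assms by simp
  have tg: "tangent D' s = tangent D s" "tangent D' t = tangent D t"
    using same_tangent_off_disc out off by auto
  have over: "s \<in> overpass D'" using same_outside[of s] out interior_subset st(3) by blast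
  show "crossing_sign D' c = crossing_sign D c"
    using b.crossing_sign_eq[OF st(1,3)] a.crossing_sign_eq[OF off(1)[OF out] over] off(2)[OF out] st(2) tg by simp
  have near: "\<forall>\<^sub>F e in at_right 0. c + e *\<^sub>R w \<notin> disc M" for w
  proof -
    have "((\<lambda>e. c + e *\<^sub>R w) \<longlongrightarrow> c + 0 *\<^sub>R w) (at_right 0)" by (intro tendsto_intros)
    then show ?thesis using assms(2) b.closed_disc by (auto dest!: topological_tendstoD[where S = "- disc M"])
  qed
  let ?z = "\<lambda>e x y. c + e *\<^sub>R (x *\<^sub>R tangent D s + y *\<^sub>R tangent D t)"
  have "\<forall>\<^sub>F e in at_right 0. \<forall>x\<in>{1, -1::real}. \<forall>y\<in>{1, -1::real}. ?z e x y \<notin> disc M"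
    using near by (intro eventually_ball_finite ballI) auto
  with b.crossing_index_eventually[OF st(1)] a.crossing_index_eventually[OF off(1)[OF out]]
  have "\<forall>\<^sub>F e in at_right (0::real). crossing_index D' c = crossing_index D c"
  proof eventually_elim
    case (elim e)
    have "crossing_index D' c = (\<Sum>x\<in>{1, -1}. \<Sum>y\<in>{1, -1}. Re (winding_number (curve D') (?z e x y))) / 4"
      using elim unfolding tg off(2)[OF out] st(2) by blast
    also have "\<dots> = (\<Sum>x\<in>{1, -1}. \<Sum>y\<in>{1, -1}. Re (winding_number (curve D) (?z e x y))) / 4"
      using elim unfolding st(2)
      by (intro arg_cong[where f = "\<lambda>r. r / 4"] sum.cong refl arg_cong[where f = Re] same_winding_off_disc) blast+
    also have "\<dots> = crossing_index D c" using elim unfolding st(2) by simp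
    finally show ?case .
  qed
  then show "crossing_index D' c = crossing_index D c"
    by (simp only: eventually_const trivial_limit_at_right_real simp_thms)
qed

end

section \<open>The change of SCI\<close>

definition sign_of :: "bool \<Rightarrow> real" where
  "sign_of P = (if P then 1 else -1)"

lemma triangle_q_eq:
  "real_of_int (triangle_q M D) =
     - (sign_of (side_agrees M D 0) * sign_of (side_agrees M D 1) * sign_of (side_agrees M D 2))"
proof -
  have "{i. i < 3 \<and> side_agrees M D i} = set (filter (side_agrees M D) [0, 1, 2])"
    using less_3_cases by auto
  then have "card {i. i < 3 \<and> side_agrees M D i} = length (filter (side_agrees M D) [0, 1, 2])"
    by (simp only: distinct_card distinct_filter distinct.simps) simp
  then show ?thesis by (simp add: triangle_q_def sign_of_def)
qed

lemma triangle_q_cases: "triangle_q M D = 1 \<or> triangle_q M D = -1"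
  by (simp add: triangle_q_def minus_one_power_iff)

lemma cyc_simps: "cyc_next 0 = 1" "cyc_next 1 = 2" "cyc_next 2 = 0"
  "cyc_prev 0 = 2" "cyc_prev 1 = 0" "cyc_prev 2 = 1"
  by (simp_all add: cyc_next_def cyc_prev_def)

lemma cyc_distinct:
  assumes "i < 3"
  shows "cyc_next i < 3" "cyc_prev i < 3" "i \<noteq> cyc_next i" "i \<noteq> cyc_prev i" "cyc_next i \<noteq> cyc_prev i"
    and "cyc_next (cyc_next i) = cyc_prev i" "cyc_prev (cyc_next i) = i"
  using less_3_cases[OF assms] by (auto simp: cyc_next_def cyc_prev_def)

text \<open>
  The move keeps the heights of the strands and reverses on each strand the order of the meetings with
  the other two.
\<close>

locale triangle_flip = strand_pair +
  assumes same_over: "\<And>i j. i < 3 \<Longrightarrow> j < 3 \<Longrightarrow> i \<noteq> j \<Longrightarrow> strand_over M D' i j \<longleftrightarrow> strand_over M D i j"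
    and flip: "\<And>i. i < 3 \<Longrightarrow> meet_time M D' i (cyc_next i) < meet_time M D' i (cyc_prev i) \<longleftrightarrow>
       meet_time M D i (cyc_prev i) < meet_time M D i (cyc_next i)"
begin

abbreviation agree :: "nat \<Rightarrow> real" where
  "agree i \<equiv> sign_of (side_agrees M D i)"

abbreviation over :: "nat \<Rightarrow> nat \<Rightarrow> real" where
  "over i j \<equiv> sign_of (strand_over M D i j)"

abbreviation crossing :: "nat \<Rightarrow> nat \<Rightarrow> complex" where
  "crossing i j \<equiv> curve D (meet_time M D i j)"

abbreviation crossing' :: "nat \<Rightarrow> nat \<Rightarrow> complex" where
  "crossing' i j \<equiv> curve D' (meet_time M D' i j)"

lemma side_agrees_flip: "i < 3 \<Longrightarrow> side_agrees M D' i \<longleftrightarrow> \<not> side_agrees M D i"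
proof -
  assume i: "i < 3"
  have "meet_time M D' i (cyc_next i) \<noteq> meet_time M D' i (cyc_prev i)"
    using a.meet_distinct[of i "cyc_next i" "cyc_prev i"] i cyc_distinct[OF i] by metis
  then show ?thesis using flip[OF i] unfolding side_agrees_def by linarith
qed

text \<open>
  The two expressions come from following the crossing along strand \<open>i\<close> and along strand \<open>j\<close>. In both
  cases only the winding number of the loop of the third strand changes, from its entry value to its
  exit value or conversely.
\<close>

lemma index_change:
  assumes i: "i < 3" and jk: "j = cyc_next i" "k = cyc_prev i"
  shows "crossing_index D' (crossing' i j) - crossing_index D (crossing i j)
      = - agree i * sgn (b.meet_det k i)"
    and "crossing_index D' (crossing' i j) - crossing_index D (crossing i j)
      = agree j * sgn (b.meet_det k j)"
proof -
  have d: "j < 3" "k < 3" "i \<noteq> j" "i \<noteq> k" "j \<noteq> k" "k \<noteq> i" "k \<noteq> j" "j \<noteq> i"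
    using cyc_distinct[OF i] jk by auto
  note same = same_boundary_indices
  have j: "cyc_next j = k" "cyc_prev j = i" using cyc_distinct[OF i] jk by auto
  have ne: "meet_time M D i j \<noteq> meet_time M D i k" "meet_time M D j i \<noteq> meet_time M D j k"
    "meet_time M D' i j \<noteq> meet_time M D' i k" "meet_time M D' j i \<noteq> meet_time M D' j k"
    using a.meet_distinct[of i j k] a.meet_distinct[of j i k] b.meet_distinct[of i j k] b.meet_distinct[of j i k] i d
    by metis+
  show "crossing_index D' (crossing' i j) - crossing_index D (crossing i j)
      = - agree i * sgn (b.meet_det k i)"
    using a.crossing_index_at_meet[of i j k] b.crossing_index_at_meet[of i j k] i d ne
      same[of i j] same[of j i] same[of k i] b.boundary_indices(3)[of k i] flip[OF i]
    by (auto simp: side_agrees_def sign_of_def jk[symmetric])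
  have "crossing_index D' (crossing' j i) - crossing_index D (crossing j i)
      = agree j * sgn (b.meet_det k j)"
    using a.crossing_index_at_meet[of j i k] b.crossing_index_at_meet[of j i k] i d ne
      same[of i j] same[of j i] same[of k j] b.boundary_indices(3)[of k j] flip[OF d(1)]
    by (auto simp: side_agrees_def sign_of_def j)
  then show "crossing_index D' (crossing' i j) - crossing_index D (crossing i j)
      = agree j * sgn (b.meet_det k j)"
    using a.meet(2)[of i j] b.meet(2)[of i j] i d by simp
qed

lemma sign_unchanged:
  assumes "i < 3" "j < 3" "i \<noteq> j"
  shows "crossing_sign D' (crossing' i j) = over i j * sgn (b.meet_det i j)"
    and "crossing_sign D (crossing i j) = over i j * sgn (b.meet_det i j)"
  using a.crossing_sign_at_meet[OF assms] b.crossing_sign_at_meet[OF assms] same_over[OF assms]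
    same_boundary_indices[OF assms] b.boundary_indices(3)[OF assms]
  by (simp_all add: sign_of_def)

lemma SCI_outside_unchanged:
  "(\<Sum>c\<in>crossings D' - disc M. crossing_sign D' c * crossing_index D' c)
   = (\<Sum>c\<in>crossings D - disc M. crossing_sign D c * crossing_index D c)"
proof -
  interpret swap: strand_pair D' D M \<beta>
    by unfold_locales (use same_outside in metis)
  have "crossings D' - disc M = crossings D - disc M"
    using crossings_off_disc swap.crossings_off_disc by blast
  then show ?thesis using same_contribution_off_disc by (intro sum.cong) auto
qed

lemma triangle_q_flip: "triangle_q M D' = - triangle_q M D"
proof -
  have "real_of_int (triangle_q M D') = - real_of_int (triangle_q M D)"
    unfolding triangle_q_eq using side_agrees_flip[of 0] side_agrees_flip[of 1] side_agrees_flip[of 2]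
    by (simp add: sign_of_def)
  then show ?thesis by linarith
qed

text \<open>
  Equating the two expressions for the change \<open>\<Delta>\<close> of each index shows that the three products of a
  determinant sign with the corresponding \<open>\<Delta>\<close> coincide, their common value being \<open>q\<close>.
\<close>

theorem SCI_change:
  "SCI D' - SCI D = real_of_int (triangle_q M D) * (over 0 1 + over 1 2 + over 2 0)"
proof -
  define \<alpha> where "\<alpha> = sgn (b.meet_det 0 1)"
  define \<gamma> where "\<gamma> = sgn (b.meet_det 1 2)"
  define \<delta> where "\<delta> = sgn (b.meet_det 2 0)"
  have pm: "\<alpha> = 1 \<or> \<alpha> = -1" "\<gamma> = 1 \<or> \<gamma> = -1" "\<delta> = 1 \<or> \<delta> = -1"
    using b.meet_det_nonzero[of 0 1] b.meet_det_nonzero[of 1 2] b.meet_det_nonzero[of 2 0]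
    by (auto simp: \<alpha>_def \<gamma>_def \<delta>_def sgn_if)
  have neg: "sgn (b.meet_det 1 0) = - \<alpha>" "sgn (b.meet_det 2 1) = - \<gamma>" "sgn (b.meet_det 0 2) = - \<delta>"
    unfolding \<alpha>_def \<gamma>_def \<delta>_def
    using b.meet_det_swap[of 1 0] b.meet_det_swap[of 2 1] b.meet_det_swap[of 0 2] by (simp_all add: sgn_minus)
  define \<Delta> where "\<Delta> = (\<lambda>i j. crossing_index D' (crossing' i j) - crossing_index D (crossing i j))"
  have \<Delta>: "\<Delta> 0 1 = - agree 0 * \<delta>" "\<Delta> 0 1 = - agree 1 * \<gamma>"
    "\<Delta> 1 2 = - agree 1 * \<alpha>" "\<Delta> 1 2 = - agree 2 * \<delta>"
    "\<Delta> 2 0 = - agree 2 * \<gamma>" "\<Delta> 2 0 = - agree 0 * \<alpha>"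
    using index_change[of 0 1 2] index_change[of 1 2 0] index_change[of 2 0 1] neg
    unfolding \<Delta>_def cyc_simps \<alpha>_def[symmetric] \<gamma>_def[symmetric] \<delta>_def[symmetric] by simp_all
  have "SCI D' - SCI D = (\<Sum>(i, j)\<in>{(0, 1), (1, 2), (2, 0)}. over i j * sgn (b.meet_det i j) * \<Delta> i j)"
    unfolding a.SCI_split b.SCI_split SCI_outside_unchanged \<Delta>_def
    using sign_unchanged[of 0 1] sign_unchanged[of 1 2] sign_unchanged[of 2 0] by (simp add: algebra_simps)
  also have "\<dots> = over 0 1 * \<alpha> * \<Delta> 0 1 + over 1 2 * \<gamma> * \<Delta> 1 2 + over 2 0 * \<delta> * \<Delta> 2 0"
    by (simp add: \<alpha>_def \<gamma>_def \<delta>_def)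
  also have "\<dots> = real_of_int (triangle_q M D) * (over 0 1 + over 1 2 + over 2 0)"
  proof -
    \<comment> \<open>For signs, \<open>x s = y t\<close> amounts to \<open>x y = s t\<close>.\<close>
    have prod: "s * (- z * t) = - (z * (x * y))"
      if "x * s = y * t" "x * x = 1" "t * t = 1" for x y z s t :: real
    proof -
      have "x * y = x * (y * t) * t" using that(3) by simp
      also have "\<dots> = (x * x) * s * t" by (simp only: that(1)[symmetric] mult.assoc)
      finally have "x * y = s * t" using that(2) by simp
      then show ?thesis by simp
    qed
    have sq: "agree i * agree i = 1" "\<alpha> * \<alpha> = 1" "\<gamma> * \<gamma> = 1" "\<delta> * \<delta> = 1" for i
      using pm by (auto simp: sign_of_def)
    have "agree 1 * \<alpha> = agree 2 * \<delta>" "agree 2 * \<gamma> = agree 0 * \<alpha>" "agree 0 * \<delta> = agree 1 * \<gamma>"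
      using \<Delta> by linarith+
    note P = prod[OF this(1) sq(1) sq(4), of "agree 0"] prod[OF this(2) sq(1) sq(2), of "agree 1"]
      prod[OF this(3) sq(1) sq(3), of "agree 2"]
    have "agree 1 * (agree 2 * agree 0) = agree 0 * (agree 1 * agree 2)"
      "agree 2 * (agree 0 * agree 1) = agree 0 * (agree 1 * agree 2)"
      by (simp_all only: mult.commute mult.left_commute)
    with P have "\<alpha> * \<Delta> 0 1 = - (agree 0 * (agree 1 * agree 2))" "\<gamma> * \<Delta> 1 2 = - (agree 0 * (agree 1 * agree 2))"
      "\<delta> * \<Delta> 2 0 = - (agree 0 * (agree 1 * agree 2))"
      by (simp_all only: \<Delta>(1,3,5))
    then have "over 0 1 * \<alpha> * \<Delta> 0 1 + over 1 2 * \<gamma> * \<Delta> 1 2 + over 2 0 * \<delta> * \<Delta> 2 0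
        = - (agree 0 * (agree 1 * agree 2)) * (over 0 1 + over 1 2 + over 2 0)"
      by (simp only: mult.assoc) (simp add: algebra_simps)
    then show ?thesis unfolding triangle_q_eq by (simp only: mult.assoc)
  qed
  finally show ?thesis .
qed

end

theorem proposition4p8:
  fixes M :: omega3_data
  assumes "omega3_move M"
  shows "(ascending M \<longrightarrow> (forward_move M \<longleftrightarrow> positive_move M)) \<and>
         (descending M \<longrightarrow> (forward_move M \<longleftrightarrow> negative_move M))"
proof -
  let ?D = "before M" and ?D' = "after M"
  note mv = assms[unfolded omega3_move_def]
  interpret b: strand_diagram ?D M by unfold_locales (use mv in auto)
  interpret a: strand_diagram ?D' M by unfold_locales (use mv in auto)
  have agree: "curve ?D' t = curve ?D t \<and> (t \<in> overpass ?D' \<longleftrightarrow> t \<in> overpass ?D)"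
    if "curve ?D t \<notin> interior (disc M) \<or> curve ?D' t \<notin> interior (disc M)" for t
  proof -
    \<comment> \<open>The move specifies the agreement only for times in one period.\<close>
    define t' where "t' = enter M 0 + frac (t - enter M 0)"
    have t': "t' - t \<in> \<int>" "t' \<in> {enter M 0..<enter M 0 + 1}"
      using frac_lt_1[of "t - enter M 0"] frac_ge_0[of "t - enter M 0"]
      by (simp_all add: t'_def, simp add: frac_def)
    have "t' \<notin> (\<Union>i<3. strand M i)"
    proof
      assume "t' \<in> (\<Union>i<3. strand M i)"
      then obtain i where "i < 3" "t' \<in> {enter M i<..<leave M i}" by (auto simp: strand_def)
      then have "curve ?D t' \<in> interior (disc M)" "curve ?D' t' \<in> interior (disc M)"
        using b.strand_interior a.strand_interior by auto
      then show False using that b.curve_congr[OF t'(1)] a.curve_congr[OF t'(1)] by simp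
    qed
    then have "curve ?D' t' = curve ?D t' \<and> (t' \<in> overpass ?D' \<longleftrightarrow> t' \<in> overpass ?D)"
      using mv t'(2) by blast
    then show ?thesis
      using b.curve_congr[OF t'(1)] a.curve_congr[OF t'(1)] b.overpass_congr[OF t'(1)] a.overpass_congr[OF t'(1)]
      by simp
  qed
  have out: "curve ?D (cut M i) \<notin> disc M" if "i \<le> 3" for i
  proof (cases "i < 3")
    case True
    then show ?thesis using b.cut_props(1,3)[OF True] by simp
  next
    case False
    then have "i = Suc 2" using that by simp
    then show ?thesis using b.cut_props(2)[of 2] b.cut_props(4)[of 2 "cut M i"] by simp
  qed
  have "path_connected (- disc M)"
    using b.disc by (rule path_connected_complement_homeomorphic_convex_compact) auto
  then have "\<forall>i. \<exists>g. path g \<and> path_image g \<subseteq> - disc M \<and> pathstart g = curve ?D (cut M 0)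
      \<and> pathfinish g = curve ?D (cut M (i mod 3))"
    using out unfolding path_connected_def by (meson ComplI less_imp_le mod_less_divisor zero_le zero_less_numeral)
  then obtain \<beta>0 where \<beta>0: "\<And>i. path (\<beta>0 i) \<and> path_image (\<beta>0 i) \<subseteq> - disc M \<and> pathstart (\<beta>0 i) = curve ?D (cut M 0)
      \<and> pathfinish (\<beta>0 i) = curve ?D (cut M (i mod 3))"
    by metis
  \<comment> \<open>The cut points \<open>0\<close> and \<open>3\<close> are the same point of the curve and need the same path.\<close>
  define \<beta> where "\<beta> = (\<lambda>i::nat. \<beta>0 (i mod 3))"
  have fin: "pathfinish (\<beta> i) = curve ?D (cut M i)" if "i \<le> 3" for i
  proof (cases "i = 3")
    case True
    then show ?thesis using \<beta>0 b.cut_3 b.curve_period[of "cut M 0" 1] by (simp add: \<beta>_def)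
  next
    case False
    then show ?thesis using that \<beta>0 by (simp add: \<beta>_def)
  qed
  have cut_same: "curve ?D' (cut M i) = curve ?D (cut M i)" if "i \<le> 3" for i
    using agree[of "cut M i"] out[OF that] interior_subset by blast
  interpret move: triangle_flip ?D ?D' M \<beta>
  proof unfold_locales
    show "curve ?D' t = curve ?D t \<and> (t \<in> overpass ?D' \<longleftrightarrow> t \<in> overpass ?D)"
      if "curve ?D t \<notin> interior (disc M) \<or> curve ?D' t \<notin> interior (disc M)" for t
      by (rule agree[OF that])
  qed (use mv fin cut_same \<beta>0 in \<open>auto simp: \<beta>_def\<close>)
  let ?q = "triangle_q M ?D"
  let ?over = "\<lambda>i j. sign_of (strand_over M ?D i j)"
  have fwd: "forward_move M \<longleftrightarrow> real_of_int ?q * (?over 0 1 + ?over 1 2 + ?over 2 0) = 1"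
    unfolding forward_move_def move.SCI_change[symmetric] by auto
  have q': "triangle_q M ?D' = - ?q" by (rule move.triangle_q_flip)
  have swap: "strand_over M ?D i j \<longleftrightarrow> \<not> strand_over M ?D j i" if "i < 3" "j < 3" "i \<noteq> j" for i j
    using move.b.strand_over_iff[OF that] .
  have "?over 0 1 + ?over 1 2 + ?over 2 0 = -1" if asc: "ascending M"
  proof -
    obtain i where i: "i < 3" "bottom_middle_top M ?D i (cyc_next i) (cyc_prev i)"
      using asc unfolding ascending_def by blast
    then show ?thesis
      using less_3_cases[OF i(1)] swap[of 0 1] swap[of 1 2] swap[of 2 0]
      by (elim disjE) (simp_all only: bottom_middle_top_def cyc_simps sign_of_def, auto)
  qed
  moreover have "?over 0 1 + ?over 1 2 + ?over 2 0 = 1" if desc: "descending M"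
  proof -
    obtain i where i: "i < 3" "bottom_middle_top M ?D (cyc_prev i) (cyc_next i) i"
      using desc unfolding descending_def by blast
    then show ?thesis
      using less_3_cases[OF i(1)] swap[of 0 1] swap[of 1 2] swap[of 2 0]
      by (elim disjE) (simp_all only: bottom_middle_top_def cyc_simps sign_of_def, auto)
  qed
  ultimately show ?thesis
    using triangle_q_cases[of M ?D] by (auto simp: fwd positive_move_def negative_move_def q')
qed

end
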